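(* There is an absolute constant $C\ge 1$ such that the following holds. For every $d\ge 1$, $M\ge 1$, $0<L\le 1$ and every $h$ with $0\le h\le \frac{1}{12\sqrt d}$, there exist parameters $\varepsilon>0$ and $\alpha>0$ (depending only on $d,M,L$) such that the control algorithm $\mathcal A$ described in the context, run with parameters $(M,L,\varepsilon,\alpha)$, satisfies $$\ell_2\text{-gain}(\mathcal A)\le \Big(\frac{C M d}{L}\Big)^{C d}.$$
   Context: **System.** Fix a dimension $d\ge1$, a horizon $T\ge 1$, and constants $M\ge 1$, $0<L\le 1$, $h\ge 0$. The system is $$x_{t+1}=Ax_t+Bu_t+w_t+f_t,\qquad t=0,1,\dots,T-1,\qquad x_0=u_0=w_0=0,$$ with $x_t,u_t,f_t,w_t\in\mathbb R^d$ and unknown $A,B\in\mathbb R^{d\times d}$ satisfying $\|A\|_2,\|B\|_2\le M$ and $\sigma_{\min}(B)>L$ (smallest singular value). The disturbances $f_t$ are arbitrary. The misspecification terms $w_t=\Delta_t(x_{1:t})$ are arbitrary functions of past states such that $\|w_{1:t}\|_2\le h\|x_{1:t}\|_2$ for all $t$. Here $y_{s:t}$ is the concatenation of $y_s,\dots,y_t$; $\|\cdot\|_2$ is the Euclidean norm for vectors and the spectral norm for matrices. The controller knows $M,L$ (not $A,B,f,w,h$) and observes $x_t$ before choosing $u_t$. **Gain.** $\ell_2\text{-gain}(\mathcal A)=\max_{f}\|x_{1:T}\|_2/\|f_{0:T-1}\|_2$ for the closed loop with $\mathcal A$. The assertion $\ell_2\text{-gain}(\mathcal A)\le\gamma$ means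 $\|x_{1:T}\|_2\le \gamma\|f_{0:T-1}\|_2$ for every $T$, all $A,B\in\mathbb R^{d\times d}$ with $\|A\|_2,\|B\|_2\le M$ and $\sigma_{\min}(B)>L$, all $(\Delta_t)$ such that $w_t=\Delta_t(x_{1:t})$ satisfies $\|w_{1:t}\|_2\le h\|x_{1:t}\|_2$ for all $t$, and all disturbance sequences $(f_t)$ in $\mathbb R^d$. **Algorithm $\mathcal A$** (parameters $M,L,\varepsilon,\alpha$). All procedures stop when time reaches $T$. $e_1,\dots,e_d$ is the standard basis. *Main loop.* Start at $t=1$ with $q=0$, $K=0$. At each time $t\le T$ observe $x_t$. If $\|x_{1:t}\|_2>\alpha q$, set $q=\|x_{1:t}\|_2$ and call SysID (starting at the current time) with budget $q$; it returns an updated $K$ and budget $q$, and the main loop resumes at the time reached by SysID. Otherwise play $u_t=-Kx_t$ and increase $t$ by 1. *SysID with budget $q$, starting at time $t$.* Step 1 (control matrix identification). For $i=0,\dots,d-1$: observe $x_{t+i}$; if $\|x_{1:t+i}\|_2>\alpha q$, restart SysID (from Step 1, at the current time) with $q=\|x_{1:t+i}\|_2$; otherwise play $u_{t+i}=\lambda_i e_{i+1}$ with $\lambda_i=4^{2i}M^{2i+1}q\,\varepsilon^{-(i+1)}$. Then observe $x_{t+d}$ and set $\hat B=\big[\tfrac{x_{t+1}}{\lambda_0}\ \cdots\ \tfrac{x_{t+d}}{\lambda_{d-1}}\big]$. If $\|x_{1:t+d}\|_2>\alpha q$ or $\sigma_{\min}(\hat B)<L/2$, restart SysID (from Step 1,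 at the current time) with $q=\|x_{1:t+d}\|_2$. Step 2. Let $t'=t+d$ be the current time and $q'=4^{2d}M^{2d}\varepsilon^{-d}q$. For $i=0,\dots,2d-1$: observe $x_{t'+i}$; if $\|x_{1:t'+i}\|_2>\alpha q$, restart SysID (from Step 1, at the current time) with $q=\|x_{1:t'+i}\|_2$; otherwise, if $i=2j$ is even play $u_{t'+i}=\xi_j\hat B^{-1}e_{j+1}$ with $\xi_j=4^{3j}M^{3j+2}q'\varepsilon^{-(j+1)}$, and if $i$ is odd play $u_{t'+i}=0$. Step 3. Observe $x_{t'+2d}$ and set $\hat A=\big[\tfrac{x_{t'+2}}{\xi_0}\ \tfrac{x_{t'+4}}{\xi_1}\ \cdots\ \tfrac{x_{t'+2d}}{\xi_{d-1}}\big]$. If $\|\hat A\|_2>2M$, restart SysID (from Step 1, at the current time) with $q=\|x_{1:t'+2d}\|_2$. Otherwise return $q$ and $K=\hat B^{-1}\hat A$. *)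

theory Defs
  imports "Jordan_Normal_Form.Spectral_Radius" "Jordan_Normal_Form.Gauss_Jordan_Elimination"
begin

(* The dimension d has to be quantified inside the formula (the constant C is chosen before d),
   so vectors and matrices are the carrier-based ones of Jordan_Normal_Form. *)

definition l2_norm :: "real vec \<Rightarrow> real" where
  "l2_norm v = sqrt (v \<bullet> v)"

(* Euclidean norm of the concatenation of a list of vectors *)
definition l2_norm_list :: "real vec list \<Rightarrow> real" where
  "l2_norm_list ys = l2_norm (foldr (@\<^sub>v) ys vNil)"

definition spectral_norm :: "real mat \<Rightarrow> real" where
  "spectral_norm A = Sup {l2_norm (A *\<^sub>v v) | v. v \<in> carrier_vec (dim_col A) \<and> l2_norm v = 1}"

definition singular_values :: "real mat \<Rightarrow> real set" where
  "singular_values A = sqrt ` spectrum (A\<^sup>T * A)"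

definition sigma_min :: "real mat \<Rightarrow> real" where
  "sigma_min A = Min (singular_values A)"

(* Only meaningful for invertible matrices; the controller inverts a matrix only after it has
   checked that its smallest singular value is positive. *)
definition inv_mat :: "real mat \<Rightarrow> real mat" where
  "inv_mat A = the (mat_inverse A)"

(* In a list xs = [x_1, ..., x_t] of observed states, x_k is xs ! (k - 1), and length xs is the
   current time. In the formulas below, e_{i+1} is unit_vec d i. *)

definition obs :: "real vec list \<Rightarrow> nat \<Rightarrow> real vec" where
  "obs xs k = xs ! (k - 1)"

definition lam :: "real \<Rightarrow> real \<Rightarrow> real \<Rightarrow> nat \<Rightarrow> real" where
  "lam M \<epsilon> q i = 4 ^ (2 * i) * M ^ (2 * i + 1) * q / \<epsilon> ^ (i + 1)"

definition q_prime :: "nat \<Rightarrow> real \<Rightarrow> real \<Rightarrow> real \<Rightarrow> real" where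
  "q_prime d M \<epsilon> q = 4 ^ (2 * d) * M ^ (2 * d) / \<epsilon> ^ d * q"

definition xi :: "nat \<Rightarrow> real \<Rightarrow> real \<Rightarrow> real \<Rightarrow> nat \<Rightarrow> real" where
  "xi d M \<epsilon> q j = 4 ^ (3 * j) * M ^ (3 * j + 2) * q_prime d M \<epsilon> q / \<epsilon> ^ (j + 1)"

(* Step 1 was started at time s with budget q *)
definition B_hat :: "nat \<Rightarrow> real \<Rightarrow> real \<Rightarrow> real \<Rightarrow> nat \<Rightarrow> real vec list \<Rightarrow> real mat" where
  "B_hat d M \<epsilon> q s xs =
     mat_of_cols d (map (\<lambda>i. (1 / lam M \<epsilon> q i) \<cdot>\<^sub>v obs xs (s + i + 1)) [0..<d])"

(* Step 2 was started at time s (called t' in the algorithm) with budget q *)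
definition A_hat :: "nat \<Rightarrow> real \<Rightarrow> real \<Rightarrow> real \<Rightarrow> nat \<Rightarrow> real vec list \<Rightarrow> real mat" where
  "A_hat d M \<epsilon> q s xs =
     mat_of_cols d (map (\<lambda>j. (1 / xi d M \<epsilon> q j) \<cdot>\<^sub>v obs xs (s + 2 * j + 2)) [0..<d])"

(* Where the controller is in its program:
     Main q K        main loop, with current values of q and K;
     Step1 q s       Step 1 of SysID, started at time s with budget q;
     Step2 q Bh s    Step 2 (or, at time s + 2d, Step 3) of SysID with budget q, where Step 2 was
                     started at time s and Bh is the estimate computed at the end of Step 1. *)
datatype ctrl_state =
    Main real "real mat"
  | Step1 real nat
  | Step2 real "real mat" nat

(* One time step of the controller: given the states observed so far (up to the current time) and
   the program position, run the program until it plays a control; the result is that control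
   and the program position at the next time. A recursive call is a jump of the program (call,
   restart, or return of SysID, or passage to the next step) that does not advance time. The
   result is None iff the program jumps forever without playing a control, as happens when
   \<alpha> < 1 and SysID is called. *)
partial_function (option) play ::
  "nat \<Rightarrow> real \<Rightarrow> real \<Rightarrow> real \<Rightarrow> real \<Rightarrow> real vec list \<Rightarrow> ctrl_state
     \<Rightarrow> (real vec \<times> ctrl_state) option" where
  "play d M L \<epsilon> \<alpha> xs c =
    (let t = length xs; N = l2_norm_list xs in
     case c of
       Main q K \<Rightarrow>
         if N > \<alpha> * q then play d M L \<epsilon> \<alpha> xs (Step1 N t)
         else Some (- (K *\<^sub>v obs xs t), Main q K)
     | Step1 q s \<Rightarrow>
         let i = t - s; Bh = B_hat d M \<epsilon> q s xs in
         if N > \<alpha> * q then play d M L \<epsilon> \<alpha> xs (Step1 N t)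
         else if i < d then Some (lam M \<epsilon> q i \<cdot>\<^sub>v unit_vec d i, Step1 q s)
         else if sigma_min Bh < L / 2 then play d M L \<epsilon> \<alpha> xs (Step1 N t)
         else play d M L \<epsilon> \<alpha> xs (Step2 q Bh t)
     | Step2 q Bh s \<Rightarrow>
         let i = t - s; Ah = A_hat d M \<epsilon> q s xs in
         if i < 2 * d then
           if N > \<alpha> * q then play d M L \<epsilon> \<alpha> xs (Step1 N t)
           else Some (if even i
                      then xi d M \<epsilon> q (i div 2) \<cdot>\<^sub>v (inv_mat Bh *\<^sub>v unit_vec d (i div 2))
                      else 0\<^sub>v d, Step2 q Bh s)
         else if spectral_norm Ah > 2 * M then play d M L \<epsilon> \<alpha> xs (Step1 N t)
         else play d M L \<epsilon> \<alpha> xs (Main q (inv_mat Bh * Ah)))"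

(* The states x_1, ..., x_t of the closed loop, and the program position of the controller at
   time t. The misspecification \<Delta> t receives the list [x_1, ..., x_t]. None means that the
   controller failed to play a control at some time before t. *)
fun closed_loop ::
  "nat \<Rightarrow> real \<Rightarrow> real \<Rightarrow> real \<Rightarrow> real \<Rightarrow> real mat \<Rightarrow> real mat
     \<Rightarrow> (nat \<Rightarrow> real vec list \<Rightarrow> real vec) \<Rightarrow> (nat \<Rightarrow> real vec)
     \<Rightarrow> nat \<Rightarrow> (real vec list \<times> ctrl_state) option" where
  "closed_loop d M L \<epsilon> \<alpha> A B \<Delta> f 0 = Some ([], Main 0 (0\<^sub>m d d))"
| "closed_loop d M L \<epsilon> \<alpha> A B \<Delta> f (Suc 0) =
     Some ([A *\<^sub>v 0\<^sub>v d + B *\<^sub>v 0\<^sub>v d + 0\<^sub>v d + f 0], Main 0 (0\<^sub>m d d))"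
| "closed_loop d M L \<epsilon> \<alpha> A B \<Delta> f (Suc (Suc t)) =
     (case closed_loop d M L \<epsilon> \<alpha> A B \<Delta> f (Suc t) of
        None \<Rightarrow> None
      | Some (xs, c) \<Rightarrow>
          (case play d M L \<epsilon> \<alpha> xs c of
             None \<Rightarrow> None
           | Some (u, c') \<Rightarrow>
               Some (xs @ [A *\<^sub>v obs xs (Suc t) + B *\<^sub>v u + \<Delta> (Suc t) xs + f (Suc t)], c')))"

(* [w_1, ..., w_t] for xs = [x_1, ..., x_t] *)
definition misspec ::
  "(nat \<Rightarrow> real vec list \<Rightarrow> real vec) \<Rightarrow> real vec list \<Rightarrow> real vec list" where
  "misspec \<Delta> xs = map (\<lambda>k. \<Delta> k (take k xs)) [1..<Suc (length xs)]"

(* The bound on w is required only along the actual trajectory, and only for the terms w_t, t < T,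
   that enter the system. The conclusion includes that the controller does play a control at
   every time before T, so a controller that gets stuck does not have finite gain. *)
definition l2_gain_le ::
  "nat \<Rightarrow> real \<Rightarrow> real \<Rightarrow> real \<Rightarrow> real \<Rightarrow> real \<Rightarrow> real \<Rightarrow> bool" where
  "l2_gain_le d M L h \<epsilon> \<alpha> \<gamma> \<longleftrightarrow>
    (\<forall>T A B \<Delta> f.
       T \<ge> 1 \<longrightarrow>
       A \<in> carrier_mat d d \<longrightarrow> B \<in> carrier_mat d d \<longrightarrow>
       spectral_norm A \<le> M \<longrightarrow> spectral_norm B \<le> M \<longrightarrow> sigma_min B > L \<longrightarrow>
       (\<forall>t. f t \<in> carrier_vec d) \<longrightarrow>
       (\<forall>t xs. length xs = t \<longrightarrow> set xs \<subseteq> carrier_vec d \<longrightarrow> \<Delta> t xs \<in> carrier_vec d) \<longrightarrow>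
       (\<forall>t xs c. 1 \<le> t \<longrightarrow> t < T \<longrightarrow> closed_loop d M L \<epsilon> \<alpha> A B \<Delta> f t = Some (xs, c) \<longrightarrow>
          l2_norm_list (misspec \<Delta> xs) \<le> h * l2_norm_list xs) \<longrightarrow>
       (\<exists>xs c. closed_loop d M L \<epsilon> \<alpha> A B \<Delta> f T = Some (xs, c) \<and>
          l2_norm_list xs \<le> \<gamma> * l2_norm_list (map f [0..<T])))"

end

theory Submission
  imports Defs "HOL-Analysis.L2_Norm"
begin

text \<open>
  Write \<open>N t\<close> for the norm of all states up to time \<open>t\<close>, \<open>F\<close> for the norm of the whole disturbance,
  \<open>q\<close> for the current budget and \<open>Z = 1 / \<epsilon> = 1024 M d / L\<close>. A disturbance is either negligible on the
  scale of the budget (\<open>F < q\<close>), and then identification succeeds, or it pays for the budget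
  (\<open>q \<le> F\<close>).

  Suppose \<open>F < q\<close>. The amplitude of every probing control exceeds all that was observed before it by a
  factor of order \<open>Z\<close>, so the next state is the response to that control up to an error that is
  \<open>O(1/Z)\<close> relative to the amplitude. In
  Step 1 this reveals the columns of \<open>B\<close> (\<open>step1_estimate\<close>). In Step 2 the control
  \<open>\<xi>\<^sub>j B_hat\<^sup>-\<^sup>1 e\<^sub>j\<close> steers the state close to \<open>\<xi>\<^sub>j e\<^sub>j\<close> (\<open>step2_probe_estimate\<close>), and the uncontrolled
  step after it shows \<open>\<xi>\<^sub>j A e\<^sub>j\<close> (\<open>step2_response_estimate\<close>). In this uncontrolled step the
  misspecification may already react to the huge state, so a column of \<open>A_hat\<close> has an error of about
  \<open>h\<close>, and \<open>A_hat\<close> an error of about \<open>h \<surd>d \<le> 1/12\<close>: this is where the bound on \<open>h\<close> comes from. The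
  feedback \<open>K = B_hat\<^sup>-\<^sup>1 A_hat\<close> then satisfies \<open>\<parallel>A - B K\<parallel> \<le> 1/4\<close> (\<open>estimated_feedback_contracts\<close>), and
  a small-gain argument keeps \<open>N t\<close> below the threshold \<open>\<alpha> q\<close> for all later times
  (\<open>settled_Suc\<close>). So nothing ever triggers a restart while \<open>F < q\<close>.

  Consequently every restart happens with \<open>q \<le> F\<close>. Until the restart \<open>N t\<close> was at most \<open>\<alpha> q\<close>, and one
  further step cannot bring it above \<open>\<Gamma> max q F\<close> with \<open>\<Gamma> = 8 M\<^sup>2 \<alpha> / L\<close> (\<open>budget_ok_Suc\<close>). The new budget,
  which is the current value of \<open>N t\<close>, is therefore at most \<open>\<Gamma> F\<close>; hence all budgets are at most
  \<open>\<Gamma> F\<close>, and \<open>N t \<le> \<Gamma> max q F \<le> \<Gamma>\<^sup>2 F\<close> at all times. The threshold \<open>\<alpha>\<close> has to exceed the growth during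
  \<open>2 d\<close> probes, each by a factor polynomial in \<open>Z\<close>, so \<open>\<Gamma>\<^sup>2\<close> is \<open>Z\<close> to a power \<open>O(d)\<close>
  (\<open>Gamma_sq_le\<close>).

  All this is organised as an invariant that relates the position of the controller in its program to
  the trajectory so far; each piece of the program preserves it (\<open>invariant_good_play\<close>).
\<close>

section \<open>Euclidean norm and operator bounds\<close>

lemma l2_norm_L2_set: "l2_norm v = L2_set (\<lambda>i. v $ i) {0..<dim_vec v}"
  by (simp add: l2_norm_def L2_set_def scalar_prod_def power2_eq_square)

lemma l2_norm_nonneg [simp]: "0 \<le> l2_norm v"
  by (simp add: l2_norm_L2_set L2_set_nonneg)

lemma l2_norm_sq: "(l2_norm v)\<^sup>2 = v \<bullet> v"
  by (auto simp: l2_norm_def scalar_prod_def intro!: sum_nonneg)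

lemma l2_norm_zero [simp]: "l2_norm (0\<^sub>v n) = 0"
  by (simp add: l2_norm_def)

lemma l2_norm_unit_vec: "i < n \<Longrightarrow> l2_norm (unit_vec n i) = 1"
  by (simp add: l2_norm_def)

lemma l2_norm_eq_0: 
  assumes "v \<in> carrier_vec n" "l2_norm v = 0" shows "v = 0\<^sub>v n"
  using assms by (intro eq_vecI) (auto simp: l2_norm_L2_set L2_set_eq_0_iff)

lemma l2_norm_triangle:
  assumes "u \<in> carrier_vec n" "v \<in> carrier_vec n"
  shows "l2_norm (u + v) \<le> l2_norm u + l2_norm v"
proof -
  have "l2_norm (u + v) = L2_set (\<lambda>i. u $ i + v $ i) {0..<n}"
    using assms unfolding l2_norm_L2_set by (intro L2_set_cong) auto
  also have "\<dots> \<le> L2_set (\<lambda>i. u $ i) {0..<n} + L2_set (\<lambda>i. v $ i) {0..<n}"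
    by (rule L2_set_triangle_ineq)
  finally show ?thesis using assms by (simp add: l2_norm_L2_set)
qed

lemma l2_norm_smult: "l2_norm (c \<cdot>\<^sub>v v) = \<bar>c\<bar> * l2_norm v"
proof -
  have "(c \<cdot>\<^sub>v v) \<bullet> (c \<cdot>\<^sub>v v) = c\<^sup>2 * (v \<bullet> v)"
    by (simp add: scalar_prod_def sum_distrib_left power2_eq_square mult_ac)
  then show ?thesis by (simp add: l2_norm_def real_sqrt_mult)
qed

lemma l2_norm_uminus [simp]: "l2_norm (- v) = l2_norm v" for v :: "real vec"
  by (simp add: l2_norm_def scalar_prod_def)

lemma scalar_prod_le_l2_norm:
  assumes "u \<in> carrier_vec n" "v \<in> carrier_vec n"
  shows "\<bar>u \<bullet> v\<bar> \<le> l2_norm u * l2_norm v"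
proof -
  have "\<bar>u \<bullet> v\<bar> \<le> (\<Sum>i = 0..<n. \<bar>u $ i\<bar> * \<bar>v $ i\<bar>)"
    using assms by (auto simp: scalar_prod_def abs_mult intro!: order_trans[OF sum_abs])
  also have "\<dots> \<le> l2_norm u * l2_norm v"
    using L2_set_mult_ineq[of "\<lambda>i. u $ i" "\<lambda>i. v $ i" "{0..<n}"] assms
    by (simp add: l2_norm_L2_set)
  finally show ?thesis .
qed

lemma norm_le_add_diff:
  assumes "u \<in> carrier_vec n" "v \<in> carrier_vec n"
  shows "l2_norm u \<le> l2_norm v + l2_norm (u - v)"
proof -
  have "u = v + (u - v)" using assms by (intro eq_vecI) auto
  then show ?thesis using l2_norm_triangle[of v n "u - v"] assms by simp
qed

lemma l2_norm_dist_triangle: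
  assumes "a \<in> carrier_vec n" "b \<in> carrier_vec n" "c \<in> carrier_vec n"
  shows "l2_norm (a - c) \<le> l2_norm (a - b) + l2_norm (b - c)"
proof -
  have "a - c = (a - b) + (b - c)" using assms by (intro eq_vecI) auto
  then show ?thesis using l2_norm_triangle[of "a - b" n "b - c"] assms by simp
qed

lemma l2_norm_rescale:
  assumes "a \<in> carrier_vec n" "c \<in> carrier_vec n" "0 < s" "l2_norm (a - s \<cdot>\<^sub>v c) \<le> r * s"
  shows "l2_norm ((1 / s) \<cdot>\<^sub>v a - c) \<le> r"
proof -
  have "(1 / s) \<cdot>\<^sub>v a - c = (1 / s) \<cdot>\<^sub>v (a - s \<cdot>\<^sub>v c)"
    using assms(1-3) by (intro eq_vecI) (auto simp: field_simps)
  then have "l2_norm ((1 / s) \<cdot>\<^sub>v a - c) = l2_norm (a - s \<cdot>\<^sub>v c) / s"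
    using assms(3) by (simp add: l2_norm_smult)
  also have "\<dots> \<le> r * s / s" using assms(3,4) by (intro divide_right_mono) auto
  finally show ?thesis using assms(3) by simp
qed

text \<open>An inequality \<open>spectral_norm D \<le> c\<close> in a form that composes without reference to the supremum in the
  definition of the spectral norm.\<close>
definition op_bound :: "real \<Rightarrow> real mat \<Rightarrow> bool" where
  "op_bound c D \<longleftrightarrow> (\<forall>v \<in> carrier_vec (dim_col D). l2_norm (D *\<^sub>v v) \<le> c * l2_norm v)"

lemma op_boundD:
  "op_bound c D \<Longrightarrow> D \<in> carrier_mat m n \<Longrightarrow> v \<in> carrier_vec n \<Longrightarrow> l2_norm (D *\<^sub>v v) \<le> c * l2_norm v"
  by (auto simp: op_bound_def)

lemma op_boundI:
  assumes "D \<in> carrier_mat m n" "\<And>v. v \<in> carrier_vec n \<Longrightarrow> l2_norm (D *\<^sub>v v) \<le> c * l2_norm v"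
  shows "op_bound c D"
  using assms by (auto simp: op_bound_def)

text \<open>The Frobenius norm dominates the operator norm, and it is at most \<open>\<surd>n\<close> times the largest column.
  Matrices are identified column by column, so this is how column errors become matrix errors.\<close>
lemma op_bound_columns:
  assumes D: "D \<in> carrier_mat m n" and "0 \<le> a" and col: "\<And>j. j < n \<Longrightarrow> l2_norm (col D j) \<le> a"
  shows "op_bound (a * sqrt n) D"
proof (rule op_boundI[OF D])
  fix v :: "real vec" assume v: "v \<in> carrier_vec n"
  have row: "((D *\<^sub>v v) $ i)\<^sup>2 \<le> (\<Sum>j = 0..<n. (D $$ (i, j))\<^sup>2) * (l2_norm v)\<^sup>2" if "i < m" for i
  proof -
    have "\<bar>(D *\<^sub>v v) $ i\<bar> \<le> l2_norm (row D i) * l2_norm v"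
      using D v that scalar_prod_le_l2_norm[of "row D i" n v] by auto
    then have "((D *\<^sub>v v) $ i)\<^sup>2 \<le> (l2_norm (row D i) * l2_norm v)\<^sup>2"
      by (metis abs_ge_zero power2_abs power_mono)
    also have "(l2_norm (row D i) * l2_norm v)\<^sup>2 = (l2_norm (row D i))\<^sup>2 * (l2_norm v)\<^sup>2"
      by (simp add: power_mult_distrib)
    also have "(l2_norm (row D i))\<^sup>2 = (\<Sum>j = 0..<n. (D $$ (i, j))\<^sup>2)"
      unfolding l2_norm_sq using D that by (simp add: scalar_prod_def power2_eq_square)
    finally show ?thesis .
  qed
  have "(l2_norm (D *\<^sub>v v))\<^sup>2 = (\<Sum>i = 0..<m. ((D *\<^sub>v v) $ i)\<^sup>2)"
    unfolding l2_norm_sq using D by (simp add: scalar_prod_def power2_eq_square)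
  also have "\<dots> \<le> (\<Sum>i = 0..<m. (\<Sum>j = 0..<n. (D $$ (i, j))\<^sup>2) * (l2_norm v)\<^sup>2)"
    using row by (intro sum_mono) auto
  also have "\<dots> = (\<Sum>i = 0..<m. \<Sum>j = 0..<n. (D $$ (i, j))\<^sup>2) * (l2_norm v)\<^sup>2"
    by (simp add: sum_distrib_right)
  also have "(\<Sum>i = 0..<m. \<Sum>j = 0..<n. (D $$ (i, j))\<^sup>2) = (\<Sum>j = 0..<n. \<Sum>i = 0..<m. (D $$ (i, j))\<^sup>2)"
    by (rule sum.swap)
  also have "\<dots> = (\<Sum>j = 0..<n. (l2_norm (col D j))\<^sup>2)"
    unfolding l2_norm_sq using D by (intro sum.cong) (auto simp: scalar_prod_def power2_eq_square)
  also have "\<dots> \<le> (\<Sum>j = 0..<n. a\<^sup>2)"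
    using col by (intro sum_mono power_mono) auto
  also have "(\<Sum>j = 0..<n. a\<^sup>2) * (l2_norm v)\<^sup>2 = (a * sqrt n * l2_norm v)\<^sup>2"
    by (simp add: power_mult_distrib)
  finally show "l2_norm (D *\<^sub>v v) \<le> a * sqrt n * l2_norm v"
    using \<open>0 \<le> a\<close> by (simp add: mult_right_mono power2_le_iff_abs_le)
qed

lemma ex_op_bound:
  assumes D: "D \<in> carrier_mat m n"
  shows "\<exists>c > 0. op_bound c D"
proof -
  define a where "a = (\<Sum>j<n. l2_norm (col D j))"
  have "op_bound (a * sqrt n) D"
    by (rule op_bound_columns[OF D]) (auto simp: a_def intro!: sum_nonneg member_le_sum)
  then have "op_bound (a * sqrt n + 1) D"
    by (auto simp: op_bound_def algebra_simps intro: order_trans)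
  moreover have "0 \<le> a" by (auto simp: a_def intro!: sum_nonneg)
  ultimately show ?thesis by (intro exI[of _ "a * sqrt n + 1"]) (auto simp: add_nonneg_pos)
qed

lemma op_bound_add:
  assumes "D \<in> carrier_mat m n" "E \<in> carrier_mat m n" "op_bound a D" "op_bound b E"
  shows "op_bound (a + b) (D + E)"
proof (rule op_boundI)
  fix v :: "real vec" assume v: "v \<in> carrier_vec n"
  have "(D + E) *\<^sub>v v = D *\<^sub>v v + E *\<^sub>v v"
    using assms v by (intro add_mult_distrib_mat_vec)
  then have "l2_norm ((D + E) *\<^sub>v v) \<le> l2_norm (D *\<^sub>v v) + l2_norm (E *\<^sub>v v)"
    using assms v l2_norm_triangle[of "D *\<^sub>v v" m "E *\<^sub>v v"] by auto
  also have "\<dots> \<le> a * l2_norm v + b * l2_norm v"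
    using assms v by (intro add_mono op_boundD)
  finally show "l2_norm ((D + E) *\<^sub>v v) \<le> (a + b) * l2_norm v"
    by (simp add: algebra_simps)
qed (use assms in auto)

lemma op_bound_mult:
  assumes "D \<in> carrier_mat m n" "E \<in> carrier_mat n k" "op_bound a D" "op_bound b E" "0 \<le> a"
  shows "op_bound (a * b) (D * E)"
proof (rule op_boundI)
  fix v :: "real vec" assume v: "v \<in> carrier_vec k"
  have "l2_norm ((D * E) *\<^sub>v v) = l2_norm (D *\<^sub>v (E *\<^sub>v v))"
    using assms v by (simp add: assoc_mult_mat_vec)
  also have "\<dots> \<le> a * l2_norm (E *\<^sub>v v)" using assms v by (intro op_boundD) auto
  also have "\<dots> \<le> a * (b * l2_norm v)" using assms v by (intro mult_left_mono op_boundD)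
  finally show "l2_norm ((D * E) *\<^sub>v v) \<le> a * b * l2_norm v" by simp
qed (use assms in auto)

lemma op_bound_mono: "op_bound a D \<Longrightarrow> a \<le> b \<Longrightarrow> op_bound b D"
  unfolding op_bound_def by (meson l2_norm_nonneg mult_right_mono order_trans)

lemma op_bound_uminus:
  assumes "D \<in> carrier_mat m n" "op_bound a D" shows "op_bound a (- D)"
proof (rule op_boundI)
  fix v :: "real vec" assume v: "v \<in> carrier_vec n"
  have "(- D) *\<^sub>v v = - (D *\<^sub>v v)"
    using assms(1) v by (intro eq_vecI) auto
  then show "l2_norm ((- D) *\<^sub>v v) \<le> a * l2_norm v"
    using op_boundD[OF assms(2,1) v] by simp
qed (use assms in auto)

text \<open>The supremum that defines the spectral norm is taken over a set that is bounded (by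
  \<open>ex_op_bound\<close>), so it is a true upper bound on the unit sphere; the rest is homogeneity.\<close>
lemma op_bound_spectral_norm:
  assumes D: "D \<in> carrier_mat m n" shows "op_bound (spectral_norm D) D"
proof (rule op_boundI[OF D])
  fix v :: "real vec" assume v: "v \<in> carrier_vec n"
  define Q where "Q = {l2_norm (D *\<^sub>v v) | v. v \<in> carrier_vec (dim_col D) \<and> l2_norm v = 1}"
  obtain c where c: "op_bound c D" using ex_op_bound[OF D] by auto
  have bdd: "bdd_above Q" unfolding Q_def
    by (rule bdd_aboveI[of _ c]) (use op_boundD[OF c D] D in fastforce)
  show "l2_norm (D *\<^sub>v v) \<le> spectral_norm D * l2_norm v"
  proof (cases "l2_norm v = 0")
    case True
    then have "v = 0\<^sub>v n" using v by (rule l2_norm_eq_0[rotated])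
    moreover have "D *\<^sub>v 0\<^sub>v n = 0\<^sub>v m" using D by auto
    ultimately show ?thesis by simp
  next
    case False
    then have pos: "0 < l2_norm v" using l2_norm_nonneg[of v] by linarith
    define u where "u = (1 / l2_norm v) \<cdot>\<^sub>v v"
    have u: "u \<in> carrier_vec n" "l2_norm u = 1"
      using v pos by (auto simp: u_def l2_norm_smult)
    have "D *\<^sub>v u = (1 / l2_norm v) \<cdot>\<^sub>v (D *\<^sub>v v)"
      unfolding u_def using D v by (rule mult_mat_vec)
    then have "l2_norm (D *\<^sub>v v) = l2_norm v * l2_norm (D *\<^sub>v u)"
      using pos by (simp add: l2_norm_smult)
    moreover have "l2_norm (D *\<^sub>v u) \<le> spectral_norm D"
      unfolding spectral_norm_def Q_def[symmetric]
      by (rule cSup_upper[OF _ bdd]) (use u D in \<open>auto simp: Q_def\<close>)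
    ultimately show ?thesis using pos by (simp add: mult.commute)
  qed
qed

lemma spectral_norm_le:
  assumes D: "D \<in> carrier_mat m n" and "0 < n" and c: "op_bound c D"
  shows "spectral_norm D \<le> c"
  unfolding spectral_norm_def
proof (rule cSup_least)
  show "{l2_norm (D *\<^sub>v v) |v. v \<in> carrier_vec (dim_col D) \<and> l2_norm v = 1} \<noteq> {}"
    using D \<open>0 < n\<close> l2_norm_unit_vec[of 0 n] by (auto intro!: exI[of _ "unit_vec n 0"])
qed (use op_boundD[OF c D] D in fastforce)

lemma mult_mat_unit_vec:
  fixes D :: "real mat"
  assumes "D \<in> carrier_mat m n" "j < n"
  shows "D *\<^sub>v unit_vec n j = col D j"
  using assms by (intro eq_vecI) auto

lemma op_bound_mat_of_cols_diff:
  fixes D :: "real mat"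
  assumes "D \<in> carrier_mat n n" "0 \<le> a" "\<And>j. j < n \<Longrightarrow> c j \<in> carrier_vec n"
    and "\<And>j. j < n \<Longrightarrow> l2_norm (c j - col D j) \<le> a"
  shows "op_bound (a * sqrt n) (mat_of_cols n (map c [0..<n]) - D)"
proof (rule op_bound_columns)
  fix j assume j: "j < n"
  have "col (mat_of_cols n (map c [0..<n]) - D) j = c j - col D j"
    using assms(1,3) j by (intro eq_vecI) (auto simp: mat_of_cols_index)
  then show "l2_norm (col (mat_of_cols n (map c [0..<n]) - D) j) \<le> a"
    using assms(4)[OF j] by simp
next
  show "mat_of_cols n (map c [0..<n]) - D \<in> carrier_mat n n"
    using assms(1) by auto
qed (use assms in auto)

lemma vec_cancel:
  fixes a b w g :: "real vec"
  assumes "a \<in> carrier_vec n" "b \<in> carrier_vec n" "w \<in> carrier_vec n" "g \<in> carrier_vec n"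
  shows "a + b + w + g - (a + b) = w + g" and "a + b + w + g - b = a + (w + g)"
  using assms by (auto intro!: eq_vecI)

lemma vec_minus_swap: "a \<in> carrier_vec n \<Longrightarrow> b \<in> carrier_vec n \<Longrightarrow> a - b = - (b - a)" for a b :: "real vec"
  by (intro eq_vecI) auto

lemma mat_minus_split:
  fixes P Q R :: "real mat"
  assumes "P \<in> carrier_mat m n" "Q \<in> carrier_mat m n" "R \<in> carrier_mat m n"
  shows "P - R = - (Q - P) + (Q - R)"
  using assms by (intro eq_matI) auto

lemma feedback_vec:
  fixes P Q K :: "real mat"
  assumes P: "P \<in> carrier_mat n n" and Q: "Q \<in> carrier_mat n n" and K: "K \<in> carrier_mat n n"
    and v: "v \<in> carrier_vec n"
  shows "P *\<^sub>v v + Q *\<^sub>v (- (K *\<^sub>v v)) = (P - Q * K) *\<^sub>v v"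
proof -
  have Kv: "K *\<^sub>v v \<in> carrier_vec n" using K v by simp
  have "Q *\<^sub>v (- (K *\<^sub>v v)) = - (Q *\<^sub>v (K *\<^sub>v v))"
    using Q Kv by (intro eq_vecI) (auto simp: scalar_prod_def sum_negf)
  then show ?thesis
    unfolding minus_mult_distrib_mat_vec[OF P mult_carrier_mat[OF Q K] v] assoc_mult_mat_vec[OF Q K v]
    using mult_mat_vec_carrier[OF P v] mult_mat_vec_carrier[OF Q Kv] by (intro eq_vecI) auto
qed

section \<open>The smallest singular value\<close>

text \<open>The smallest singular value is defined through the eigenvalues of \<open>D\<^sup>T D\<close>, whereas the analysis needs
  it as the best constant \<open>c\<close> with \<open>c \<parallel>v\<parallel> \<le> \<parallel>D v\<parallel>\<close>. The link is that the infimum of the Rayleigh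
  quotient is an eigenvalue.\<close>
lemma mult_mat_vec_sq_norm:
  fixes D :: "real mat"
  assumes D: "D \<in> carrier_mat m n" and v: "v \<in> carrier_vec n"
  shows "v \<bullet> ((D\<^sup>T * D) *\<^sub>v v) = (l2_norm (D *\<^sub>v v))\<^sup>2"
proof -
  have "(D\<^sup>T * D) *\<^sub>v v = D\<^sup>T *\<^sub>v (D *\<^sub>v v)" using D v by auto
  moreover have "v \<bullet> (D\<^sup>T *\<^sub>v (D *\<^sub>v v)) = (D\<^sup>T *\<^sub>v (D *\<^sub>v v)) \<bullet> v"
    using D v by (intro comm_scalar_prod[of _ n]) auto
  moreover have "\<dots> = (D *\<^sub>v v) \<bullet> (D *\<^sub>v v)"
    using D v by (intro transpose_vec_mult_scalar[of _ m n]) auto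
  ultimately show ?thesis by (simp add: l2_norm_sq)
qed

lemma scalar_prod_add_smult:
  fixes u w x y :: "real vec"
  assumes "u \<in> carrier_vec n" "w \<in> carrier_vec n" "x \<in> carrier_vec n" "y \<in> carrier_vec n"
  shows "(u + c \<cdot>\<^sub>v w) \<bullet> (x + c \<cdot>\<^sub>v y) = u \<bullet> x + c * (w \<bullet> x) + c * (u \<bullet> y) + c * c * (w \<bullet> y)"
proof -
  have "(u + c \<cdot>\<^sub>v w) \<bullet> (x + c \<cdot>\<^sub>v y) = u \<bullet> (x + c \<cdot>\<^sub>v y) + (c \<cdot>\<^sub>v w) \<bullet> (x + c \<cdot>\<^sub>v y)"
    using assms by (intro add_scalar_prod_distrib[of _ n]) auto
  also have "u \<bullet> (x + c \<cdot>\<^sub>v y) = u \<bullet> x + u \<bullet> (c \<cdot>\<^sub>v y)"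
    using assms by (intro scalar_prod_add_distrib[of _ n]) auto
  also have "(c \<cdot>\<^sub>v w) \<bullet> (x + c \<cdot>\<^sub>v y) = (c \<cdot>\<^sub>v w) \<bullet> x + (c \<cdot>\<^sub>v w) \<bullet> (c \<cdot>\<^sub>v y)"
    using assms by (intro scalar_prod_add_distrib[of _ n]) auto
  finally show ?thesis using assms by simp
qed

text \<open>Let \<open>a\<close> bound \<open>H\<close>. That the quadratic form of \<open>H\<close> is nonnegative at \<open>u - H u / a\<close> gives
  \<open>\<parallel>H u\<parallel>\<^sup>2 / a \<le> \<langle>u, H u\<rangle>\<close>, and \<open>\<parallel>u\<parallel> \<le> \<parallel>J\<parallel> \<parallel>H u\<parallel>\<close>.\<close>
lemma psd_invertible_coercive:
  fixes H J :: "real mat"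
  assumes H: "H \<in> carrier_mat n n" and J: "J \<in> carrier_mat n n" "J * H = 1\<^sub>m n"
    and sym: "H\<^sup>T = H" and psd: "\<And>u. u \<in> carrier_vec n \<Longrightarrow> 0 \<le> u \<bullet> (H *\<^sub>v u)"
  shows "\<exists>\<kappa> > 0. \<forall>u \<in> carrier_vec n. \<kappa> * (l2_norm u)\<^sup>2 \<le> u \<bullet> (H *\<^sub>v u)"
proof -
  obtain a where a: "0 < a" "op_bound a H" using ex_op_bound[OF H] by auto
  obtain b where b: "0 < b" "op_bound b J" using ex_op_bound[OF J(1)] by auto
  have "1 / (a * b\<^sup>2) * (l2_norm u)\<^sup>2 \<le> u \<bullet> (H *\<^sub>v u)" if u: "u \<in> carrier_vec n" for u
  proof -
    define w where "w = H *\<^sub>v u"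
    have w: "w \<in> carrier_vec n" using H u by (simp add: w_def)
    have Hw: "H *\<^sub>v w \<in> carrier_vec n" using H w by simp
    (* minimiser of the upper bound for the form at u + c w that follows from norm H <= a *)
    define c where "c = - 1 / a"
    have uHw: "u \<bullet> (H *\<^sub>v w) = w \<bullet> w"
    proof -
      have "w \<bullet> w = (H\<^sup>T *\<^sub>v u) \<bullet> w" by (simp add: sym w_def)
      also have "\<dots> = u \<bullet> (H *\<^sub>v w)" using H u w by (intro transpose_vec_mult_scalar)
      finally show ?thesis by simp
    qed
    have "0 \<le> (u + c \<cdot>\<^sub>v w) \<bullet> (H *\<^sub>v (u + c \<cdot>\<^sub>v w))"
      using u w by (intro psd) auto
    also have "H *\<^sub>v (u + c \<cdot>\<^sub>v w) = w + c \<cdot>\<^sub>v (H *\<^sub>v w)"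
      using H u w by (simp add: w_def mult_add_distrib_mat_vec mult_mat_vec)
    also have "(u + c \<cdot>\<^sub>v w) \<bullet> (w + c \<cdot>\<^sub>v (H *\<^sub>v w))
        = u \<bullet> w + c * (w \<bullet> w) + c * (u \<bullet> (H *\<^sub>v w)) + c * c * (w \<bullet> (H *\<^sub>v w))"
      by (rule scalar_prod_add_smult[OF u w w Hw])
    also have "\<dots> = u \<bullet> w + 2 * c * (l2_norm w)\<^sup>2 + c * c * (w \<bullet> (H *\<^sub>v w))"
      by (simp add: uHw l2_norm_sq)
    also have "w \<bullet> (H *\<^sub>v w) \<le> l2_norm w * l2_norm (H *\<^sub>v w)"
      using scalar_prod_le_l2_norm[OF w Hw] by simp
    also have "\<dots> \<le> l2_norm w * (a * l2_norm w)"
      using op_boundD[OF a(2) H w] by (simp add: mult_left_mono)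
    finally have "0 \<le> u \<bullet> w + 2 * c * (l2_norm w)\<^sup>2 + c * c * (l2_norm w * (a * l2_norm w))"
      by (simp add: mult_left_mono)
    also have "\<dots> = u \<bullet> w - (l2_norm w)\<^sup>2 / a"
      using a by (simp add: c_def power2_eq_square field_simps)
    finally have 1: "(l2_norm w)\<^sup>2 / a \<le> u \<bullet> w" by simp
    have "u = J *\<^sub>v w"
      using assoc_mult_mat_vec[OF J(1) H u] J(2) u by (simp add: w_def)
    then have "l2_norm u \<le> b * l2_norm w" using op_boundD[OF b(2) J(1) w] by simp
    then have "(l2_norm u)\<^sup>2 \<le> (b * l2_norm w)\<^sup>2" by (intro power_mono) auto
    then have "1 / (a * b\<^sup>2) * (l2_norm u)\<^sup>2 \<le> (l2_norm w)\<^sup>2 / a"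
      using a b by (simp add: field_simps)
    with 1 show ?thesis by (simp add: w_def)
  qed
  moreover have "0 < 1 / (a * b\<^sup>2)" using a b by simp
  ultimately show ?thesis by blast
qed

text \<open>The witness is the infimum \<open>r\<close> of \<open>\<parallel>D v\<parallel>\<^sup>2\<close> over unit vectors. The form of \<open>D\<^sup>T D - r I\<close> is
  nonnegative; were this matrix invertible, the form would be bounded below by some \<open>\<kappa> > 0\<close> on unit
  vectors, and \<open>r + \<kappa>\<close> would still be a lower bound of the quotient.\<close>
lemma ex_eigenvalue_le_Rayleigh:
  fixes D :: "real mat"
  assumes D: "D \<in> carrier_mat m n" and "0 < n"
  shows "\<exists>r \<in> spectrum (D\<^sup>T * D). \<forall>v \<in> carrier_vec n. r * (l2_norm v)\<^sup>2 \<le> (l2_norm (D *\<^sub>v v))\<^sup>2"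
proof -
  define Q where "Q = {(l2_norm (D *\<^sub>v v))\<^sup>2 | v. v \<in> carrier_vec n \<and> l2_norm v = 1}"
  define r where "r = Inf Q"
  have bdd: "bdd_below Q" by (rule bdd_belowI[of _ 0]) (auto simp: Q_def)
  have ne: "Q \<noteq> {}"
    using \<open>0 < n\<close> l2_norm_unit_vec[of 0 n] by (auto simp: Q_def intro!: exI[of _ "unit_vec n 0"])
  have r_le: "r * (l2_norm v)\<^sup>2 \<le> (l2_norm (D *\<^sub>v v))\<^sup>2" if v: "v \<in> carrier_vec n" for v
  proof (cases "l2_norm v = 0")
    case False
    then have pos: "0 < l2_norm v" using l2_norm_nonneg[of v] by linarith
    define u where "u = (1 / l2_norm v) \<cdot>\<^sub>v v"
    have u: "u \<in> carrier_vec n" "l2_norm u = 1"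
      using v pos by (auto simp: u_def l2_norm_smult)
    have "D *\<^sub>v u = (1 / l2_norm v) \<cdot>\<^sub>v (D *\<^sub>v v)"
      unfolding u_def using D v by (rule mult_mat_vec)
    then have "l2_norm (D *\<^sub>v v) = l2_norm v * l2_norm (D *\<^sub>v u)"
      using pos by (simp add: l2_norm_smult)
    moreover have "r \<le> (l2_norm (D *\<^sub>v u))\<^sup>2"
      unfolding r_def by (rule cInf_lower[OF _ bdd]) (use u in \<open>auto simp: Q_def\<close>)
    ultimately show ?thesis
      by (metis mult.commute mult_right_mono power_mult_distrib zero_le_power2)
  qed simp
  define G where "G = D\<^sup>T * D"
  have G: "G \<in> carrier_mat n n" using D by (simp add: G_def)
  define H where "H = G + (- r) \<cdot>\<^sub>m 1\<^sub>m n"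
  have H: "H \<in> carrier_mat n n" using G by (simp add: H_def)
  have Hv: "H *\<^sub>v v = G *\<^sub>v v + (- r) \<cdot>\<^sub>v v" if v: "v \<in> carrier_vec n" for v
    unfolding H_def using G v by (auto simp: add_mult_distrib_mat_vec)
  have quad: "v \<bullet> (H *\<^sub>v v) = (l2_norm (D *\<^sub>v v))\<^sup>2 - r * (l2_norm v)\<^sup>2"
    if v: "v \<in> carrier_vec n" for v
  proof -
    have "v \<bullet> (H *\<^sub>v v) = v \<bullet> (G *\<^sub>v v) + v \<bullet> ((- r) \<cdot>\<^sub>v v)"
      unfolding Hv[OF v] using G v by (intro scalar_prod_add_distrib[of _ n]) auto
    then show ?thesis
      using v mult_mat_vec_sq_norm[OF D v] by (simp add: G_def l2_norm_sq)
  qed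
  have "det H = 0"
  proof (rule ccontr)
    assume "det H \<noteq> 0"
    then obtain J where J: "J \<in> carrier_mat n n" "J * H = 1\<^sub>m n"
      using det_non_zero_imp_unit[OF H, of undefined] unfolding Units_def ring_mat_def by auto
    have "G\<^sup>T = G" using D by (auto simp: G_def transpose_mult)
    then have sym: "H\<^sup>T = H"
    proof -
      have "(- r \<cdot>\<^sub>m 1\<^sub>m n)\<^sup>T = - r \<cdot>\<^sub>m 1\<^sub>m n" by (rule eq_matI) auto
      then show ?thesis using G \<open>G\<^sup>T = G\<close> by (simp add: H_def transpose_add[of _ n n])
    qed
    have "0 \<le> u \<bullet> (H *\<^sub>v u)" if "u \<in> carrier_vec n" for u
      using quad[OF that] r_le[OF that] by simp
    from psd_invertible_coercive[OF H J sym this]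
    obtain \<kappa> where "\<kappa> > 0" "\<forall>u \<in> carrier_vec n. \<kappa> * (l2_norm u)\<^sup>2 \<le> u \<bullet> (H *\<^sub>v u)" by blast
    then have \<kappa>: "\<kappa> > 0" "\<And>u. u \<in> carrier_vec n \<Longrightarrow> \<kappa> * (l2_norm u)\<^sup>2 \<le> u \<bullet> (H *\<^sub>v u)" by auto
    have "r + \<kappa> \<le> r"
      unfolding r_def
    proof (rule cInf_greatest[OF ne])
      fix y assume "y \<in> Q"
      then obtain u where u: "u \<in> carrier_vec n" "l2_norm u = 1" "y = (l2_norm (D *\<^sub>v u))\<^sup>2"
        by (auto simp: Q_def)
      then show "Inf Q + \<kappa> \<le> y" using \<kappa>(2)[OF u(1)] quad[OF u(1)] by (simp add: r_def)
    qed
    then show False using \<kappa>(1) by simp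
  qed
  then obtain v where v: "v \<in> carrier_vec n" "v \<noteq> 0\<^sub>v n" "H *\<^sub>v v = 0\<^sub>v n"
    using det_0_iff_vec_prod_zero_field[OF H] by auto
  have Gv: "G *\<^sub>v v \<in> carrier_vec n" using G v by auto
  have "G *\<^sub>v v = r \<cdot>\<^sub>v v"
  proof (rule eq_vecI)
    fix i assume "i < dim_vec (r \<cdot>\<^sub>v v)"
    then have i: "i < n" using v by simp
    have "G *\<^sub>v v + (- r) \<cdot>\<^sub>v v = 0\<^sub>v n" using Hv[OF v(1)] v(3) by argo
    then have "(G *\<^sub>v v + (- r) \<cdot>\<^sub>v v) $ i = 0" using i by simp
    then show "(G *\<^sub>v v) $ i = (r \<cdot>\<^sub>v v) $ i" using i v Gv by simp
  qed (use Gv v G in auto)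
  then have "eigenvalue G r" using v G unfolding eigenvalue_def eigenvector_def by auto
  then have "r \<in> spectrum (D\<^sup>T * D)" by (simp add: spectrum_def G_def)
  with r_le show ?thesis by blast
qed

lemma
  fixes D :: "real mat"
  assumes D: "D \<in> carrier_mat m n" and "0 < n"
  shows sigma_min_le: "\<And>v. v \<in> carrier_vec n \<Longrightarrow> sigma_min D * l2_norm v \<le> l2_norm (D *\<^sub>v v)"
    and sigma_min_ge: "\<And>c. 0 \<le> c \<Longrightarrow> (\<And>v. v \<in> carrier_vec n \<Longrightarrow> c * l2_norm v \<le> l2_norm (D *\<^sub>v v)) 
      \<Longrightarrow> c \<le> sigma_min D"
proof -
  define G where "G = D\<^sup>T * D"
  have G: "G \<in> carrier_mat n n" using D by (simp add: G_def)
  obtain r where r: "r \<in> spectrum G" "\<And>v. v \<in> carrier_vec n \<Longrightarrow> r * (l2_norm v)\<^sup>2 \<le> (l2_norm (D *\<^sub>v v))\<^sup>2"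
    using ex_eigenvalue_le_Rayleigh[OF assms] by (auto simp: G_def)
  have fin: "finite (singular_values D)"
    using card_finite_spectrum(1)[OF G] by (simp add: singular_values_def G_def)
  show "sigma_min D * l2_norm v \<le> l2_norm (D *\<^sub>v v)" if v: "v \<in> carrier_vec n" for v
  proof -
    have "sigma_min D \<le> sqrt r"
      unfolding sigma_min_def using fin r(1) by (intro Min_le) (auto simp: singular_values_def G_def)
    then have "sigma_min D * l2_norm v \<le> sqrt r * l2_norm v" by (simp add: mult_right_mono)
    also have "\<dots> = sqrt (r * (l2_norm v)\<^sup>2)" by (simp add: real_sqrt_mult)
    also have "\<dots> \<le> sqrt ((l2_norm (D *\<^sub>v v))\<^sup>2)" using r(2)[OF v] by (rule real_sqrt_le_mono)
    finally show ?thesis by simp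
  qed
  show "c \<le> sigma_min D"
    if c: "0 \<le> c" "\<And>v. v \<in> carrier_vec n \<Longrightarrow> c * l2_norm v \<le> l2_norm (D *\<^sub>v v)" for c
    unfolding sigma_min_def
  proof (rule Min.boundedI[OF fin])
    show "singular_values D \<noteq> {}" using r(1) by (auto simp: singular_values_def G_def)
    fix s assume "s \<in> singular_values D"
    then obtain k where k: "eigenvalue G k" "s = sqrt k"
      by (auto simp: singular_values_def G_def spectrum_def)
    then obtain v where v: "v \<in> carrier_vec n" "v \<noteq> 0\<^sub>v n" "G *\<^sub>v v = k \<cdot>\<^sub>v v"
      using G by (auto simp: eigenvalue_def eigenvector_def)
    have pos: "0 < (l2_norm v)\<^sup>2"
      using l2_norm_eq_0[OF v(1)] v(2) by auto
    have "c\<^sup>2 * (l2_norm v)\<^sup>2 \<le> (l2_norm (D *\<^sub>v v))\<^sup>2"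
      using power_mono[OF c(2)[OF v(1)], of 2] c(1) by (simp add: power_mult_distrib)
    also have "\<dots> = k * (l2_norm v)\<^sup>2"
      using mult_mat_vec_sq_norm[OF D v(1)] v by (simp add: G_def l2_norm_sq)
    finally have "c\<^sup>2 \<le> k" using pos by (rule mult_right_le_imp_le)
    then show "c \<le> s" using k c by (simp add: real_le_rsqrt)
  qed
qed

lemma inv_mat_of_bounded_below:
  fixes D :: "real mat"
  assumes D: "D \<in> carrier_mat n n" and "0 < c"
    and below: "\<And>v. v \<in> carrier_vec n \<Longrightarrow> c * l2_norm v \<le> l2_norm (D *\<^sub>v v)"
  shows "inv_mat D \<in> carrier_mat n n" "D * inv_mat D = 1\<^sub>m n" "op_bound (1 / c) (inv_mat D)"
proof -
  have "det D \<noteq> 0"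
  proof
    assume "det D = 0"
    then obtain v where v: "v \<in> carrier_vec n" "v \<noteq> 0\<^sub>v n" "D *\<^sub>v v = 0\<^sub>v n"
      using det_0_iff_vec_prod_zero_field[OF D] by auto
    then have "c * l2_norm v \<le> 0" using below[of v] by simp
    then have "l2_norm v = 0" using \<open>0 < c\<close> l2_norm_nonneg[of v] by (smt (verit) mult_pos_pos)
    then show False using l2_norm_eq_0 v by blast
  qed
  then have "mat_inverse D \<noteq> None"
    using det_non_zero_imp_unit[OF D, of undefined] mat_inverse(1)[OF D, of undefined] by blast
  then have *: "D * inv_mat D = 1\<^sub>m n \<and> inv_mat D * D = 1\<^sub>m n \<and> inv_mat D \<in> carrier_mat n n"
    using mat_inverse(2)[OF D] by (auto simp: inv_mat_def)
  then show I: "inv_mat D \<in> carrier_mat n n" and DI: "D * inv_mat D = 1\<^sub>m n" by auto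
  show "op_bound (1 / c) (inv_mat D)"
  proof (rule op_boundI[OF I])
    fix v :: "real vec" assume v: "v \<in> carrier_vec n"
    have "D *\<^sub>v (inv_mat D *\<^sub>v v) = v"
      using assoc_mult_mat_vec[OF D I v] DI v by simp
    then have "c * l2_norm (inv_mat D *\<^sub>v v) \<le> l2_norm v"
      using below[of "inv_mat D *\<^sub>v v"] I v by simp
    then show "l2_norm (inv_mat D *\<^sub>v v) \<le> 1 / c * l2_norm v"
      using \<open>0 < c\<close> by (simp add: field_simps)
  qed
qed

section \<open>Energy of a trajectory\<close>

text \<open>Norms of concatenations are square roots of sums of squares, which grow by one term per time step.\<close>
lemma l2_norm_list_eq: "l2_norm_list ys = sqrt (\<Sum>y\<leftarrow>ys. (l2_norm y)\<^sup>2)"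
proof -
  have "foldr (@\<^sub>v) ys vNil \<bullet> foldr (@\<^sub>v) ys vNil = (\<Sum>y\<leftarrow>ys. (l2_norm y)\<^sup>2)"
  proof (induction ys)
    case (Cons y ys)
    have "(y @\<^sub>v foldr (@\<^sub>v) ys vNil) \<bullet> (y @\<^sub>v foldr (@\<^sub>v) ys vNil)
        = y \<bullet> y + foldr (@\<^sub>v) ys vNil \<bullet> foldr (@\<^sub>v) ys vNil"
      by (rule scalar_prod_append) (rule carrier_vec_dim_vec)+
    then show ?case using Cons by (simp add: l2_norm_sq)
  qed (simp add: scalar_prod_def)
  then show ?thesis by (simp add: l2_norm_list_def l2_norm_def)
qed

text \<open>States are numbered from 1, so the sum leaves out \<open>x 0\<close>.\<close>
definition energy :: "(nat \<Rightarrow> real vec) \<Rightarrow> nat \<Rightarrow> real" where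
  "energy x t = (\<Sum>k = 1..t. (l2_norm (x k))\<^sup>2)"

lemma energy_0 [simp]: "energy x 0 = 0"
  by (simp add: energy_def)

lemma energy_Suc: "energy x (Suc t) = energy x t + (l2_norm (x (Suc t)))\<^sup>2"
  by (simp add: energy_def)

lemma energy_nonneg [simp]: "0 \<le> energy x t"
  by (auto simp: energy_def intro: sum_nonneg)

lemma energy_mono: "s \<le> t \<Longrightarrow> energy x s \<le> energy x t"
  unfolding energy_def by (intro sum_mono2) auto

lemma norm_le_sqrt_energy:
  assumes "1 \<le> t" shows "l2_norm (x t) \<le> sqrt (energy x t)"
proof -
  obtain s where "t = Suc s" using assms by (cases t) auto
  then show ?thesis by (simp add: energy_Suc real_le_rsqrt)
qed

lemma l2_norm_list_energy: "l2_norm_list (map x [1..<Suc t]) = sqrt (energy x t)"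
  by (induction t) (auto simp: l2_norm_list_eq energy_Suc)

lemma l2_norm_list_upt_0: "l2_norm_list (map g [0..<T]) = sqrt (\<Sum>k<T. (l2_norm (g k))\<^sup>2)"
  by (induction T) (auto simp: l2_norm_list_eq)

lemma sum3_sq_le: "(a + b + c)\<^sup>2 \<le> 3 * (a\<^sup>2 + b\<^sup>2 + c\<^sup>2)" for a b c :: real
  using sum_squares_ge_zero[of "a - b" "b - c"] zero_le_square[of "a - c"]
  by (simp add: power2_eq_square algebra_simps)

section \<open>The parameters and the closed loop\<close>
text \<open>The inverse of the parameter \<open>\<epsilon>\<close>.\<close>
definition probe_ratio :: "nat \<Rightarrow> real \<Rightarrow> real \<Rightarrow> real" where
  "probe_ratio d M L = 1024 * M * real d / L"

text \<open>The parameter \<open>\<alpha>\<close>: four times the bound on \<open>N t / q\<close> at the end of an identification with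
  \<open>F \<le> q\<close>. The factor 4 is for the transient of the feedback loop.\<close>
definition alarm_factor :: "nat \<Rightarrow> real \<Rightarrow> real \<Rightarrow> real" where
  "alarm_factor d M L = 4 * ((64 * M ^ 3 * probe_ratio d M L) ^ d * (16 * M\<^sup>2 * probe_ratio d M L) ^ d)"

text \<open>The sequences \<open>X\<close>, \<open>W\<close> and \<open>f\<close> are arbitrary here. The dynamics and the bound on the
  misspecification are hypotheses about single times (\<open>driven\<close> and \<open>bounded_misspec\<close> below), because
  they are available only for times that the closed loop is known to reach.\<close>
locale controlled_system =
  fixes d :: nat and M L h :: real and A B :: "real mat" and X W f :: "nat \<Rightarrow> real vec" and T :: nat
  assumes d_pos: "1 \<le> d" and M_ge: "1 \<le> M" and L_pos: "0 < L" and L_le: "L \<le> 1"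
    and h_nonneg: "0 \<le> h" and h_le: "h \<le> 1 / (12 * sqrt (real d))"
    and A [simp]: "A \<in> carrier_mat d d" and B [simp]: "B \<in> carrier_mat d d"
    and A_bound: "op_bound M A" and B_bound: "op_bound M B"
    and B_below: "\<And>v. v \<in> carrier_vec d \<Longrightarrow> L * l2_norm v \<le> l2_norm (B *\<^sub>v v)"
    and X [simp]: "\<And>t. X t \<in> carrier_vec d" and W [simp]: "\<And>t. W t \<in> carrier_vec d"
    and f [simp]: "\<And>t. f t \<in> carrier_vec d"
begin

lemma dims [simp]: "dim_row A = d" "dim_col A = d" "dim_row B = d" "dim_col B = d"
  "dim_vec (X t) = d" "dim_vec (W t) = d" "dim_vec (f t) = d"
  using A B X W f by (auto simp del: A B X W f)

definition F :: real where "F = sqrt (\<Sum>k<T. (l2_norm (f k))\<^sup>2)"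

definition N :: "nat \<Rightarrow> real" where "N t = sqrt (energy X t)"

definition Z :: real where "Z = probe_ratio d M L"

text \<open>If \<open>F \<le> q\<close>, these bound the norm of the states observed before probe \<open>i\<close> of Step 1, and before probe \<open>j\<close> of
  Step 2. The amplitudes prescribed by the algorithm are \<open>M Z\<close> and \<open>M\<^sup>2 Z\<close> times these bounds
  (\<open>lam_eq\<close>, \<open>xi_eq\<close>).\<close>
definition step1_bound :: "real \<Rightarrow> nat \<Rightarrow> real" where
  "step1_bound q i = (16 * M\<^sup>2 * Z) ^ i * q"

definition step2_bound :: "real \<Rightarrow> nat \<Rightarrow> real" where
  "step2_bound q j = (64 * M ^ 3 * Z) ^ j * step1_bound q d"

definition \<alpha> :: real where "\<alpha> = alarm_factor d M L"

text \<open>One step that starts with \<open>N t \<le> \<alpha> q\<close> ends with \<open>N (Suc t) \<le> \<Gamma> max q F\<close>.\<close>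
definition \<Gamma> :: real where "\<Gamma> = 8 * M\<^sup>2 * \<alpha> / L"

definition bounded_misspec :: "nat \<Rightarrow> bool" where
  "bounded_misspec t \<longleftrightarrow> 1 \<le> t \<and> t < T \<and> energy W t \<le> h\<^sup>2 * energy X t"

definition driven :: "nat \<Rightarrow> real vec \<Rightarrow> bool" where
  "driven t u \<longleftrightarrow> X (Suc t) = A *\<^sub>v X t + B *\<^sub>v u + W t + f t"

lemma F_nonneg [simp]: "0 \<le> F"
  by (auto simp: F_def intro: sum_nonneg)

lemma N_nonneg [simp]: "0 \<le> N t"
  by (simp add: N_def)

lemma N_sq: "(N t)\<^sup>2 = energy X t"
  by (simp add: N_def)

lemma N_mono: "s \<le> t \<Longrightarrow> N s \<le> N t"
  by (simp add: N_def energy_mono)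

lemma N_0 [simp]: "N 0 = 0"
  by (simp add: N_def)

lemma norm_X_le: "1 \<le> t \<Longrightarrow> l2_norm (X t) \<le> N t"
  using norm_le_sqrt_energy[of t X] by (simp add: N_def)

lemma N_Suc_le: "N (Suc t) \<le> N t + l2_norm (X (Suc t))"
proof -
  have "energy X (Suc t) \<le> (N t + l2_norm (X (Suc t)))\<^sup>2"
    by (simp add: energy_Suc power2_sum N_sq)
  then show ?thesis unfolding N_def[of "Suc t"] by (intro real_le_lsqrt) auto
qed

lemma norm_f_le:
  assumes "t < T" shows "l2_norm (f t) \<le> F"
proof -
  have "(l2_norm (f t))\<^sup>2 \<le> (\<Sum>k<T. (l2_norm (f k))\<^sup>2)"
    using assms by (intro member_le_sum) auto
  then show ?thesis unfolding F_def by (rule real_le_rsqrt)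
qed

lemma norm_W_le:
  assumes "bounded_misspec t" shows "l2_norm (W t) \<le> h * N t"
proof -
  have "l2_norm (W t) \<le> sqrt (energy W t)"
    using assms by (intro norm_le_sqrt_energy) (auto simp: bounded_misspec_def)
  also have "\<dots> \<le> sqrt (h\<^sup>2 * energy X t)"
    using assms by (simp add: bounded_misspec_def)
  also have "\<dots> = h * N t" using h_nonneg by (simp add: N_def real_sqrt_mult)
  finally show ?thesis .
qed

lemma sqrt_d_ge: "1 \<le> sqrt (real d)"
  using d_pos by simp

lemma h_sqrt_d: "h * sqrt (real d) \<le> 1 / 12"
  using h_le sqrt_d_ge by (simp add: field_simps)

lemma h_le_12: "h \<le> 1 / 12"
  using h_sqrt_d mult_left_mono[OF sqrt_d_ge h_nonneg] by linarith

text \<open>An error of \<open>B_hat\<close> is amplified by \<open>1/L\<close> in the inversion and by \<open>M\<close> in the response of the system,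
  and \<open>\<surd>d\<close> is lost from columns to matrices; so \<open>Z\<close> has to be large compared with \<open>M \<surd>d / L\<close>.\<close>
lemma Z_bounds: "1024 \<le> Z" "1024 * M * sqrt (real d) \<le> Z * L" "1024 * M \<le> Z * L"
   "M \<le> Z" "1 / L \<le> Z" "0 < Z"
proof -
  have sd: "sqrt (real d) \<le> real d"
    using d_pos by (intro real_le_lsqrt) (auto simp: power2_eq_square)
  have ZL: "Z * L = 1024 * M * real d" using L_pos by (simp add: Z_def probe_ratio_def)
  then show b: "1024 * M * sqrt (real d) \<le> Z * L" using sd M_ge by simp
  show c: "1024 * M \<le> Z * L" using ZL d_pos M_ge by simp
  have "0 < Z * L" using c M_ge by linarith
  then show Zpos: "0 < Z" using L_pos by (simp add: zero_less_mult_iff)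
  have "Z * L \<le> Z * 1" using L_le Zpos by (intro mult_left_mono) auto
  then show "1024 \<le> Z" "M \<le> Z" using c M_ge by auto
  show "1 / L \<le> Z" using c M_ge L_pos by (simp add: field_simps)
qed

lemma growth_factors: "1 \<le> 16 * M\<^sup>2 * Z" "1 \<le> 64 * M ^ 3 * Z"
proof -
  have "1 * 1 \<le> M\<^sup>2 * Z" "1 * 1 \<le> M ^ 3 * Z"
    using M_ge Z_bounds by (intro mult_mono; simp)+
  then show "1 \<le> 16 * M\<^sup>2 * Z" "1 \<le> 64 * M ^ 3 * Z" by auto
qed

lemma step1_bound_0 [simp]: "step1_bound q 0 = q"
  by (simp add: step1_bound_def)

lemma step1_bound_Suc: "step1_bound q (Suc i) = 16 * M\<^sup>2 * Z * step1_bound q i"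
  by (simp add: step1_bound_def)

lemma step1_bound_mono: "0 \<le> q \<Longrightarrow> i \<le> j \<Longrightarrow> step1_bound q i \<le> step1_bound q j"
  unfolding step1_bound_def using growth_factors by (intro mult_right_mono power_increasing) auto

lemma step2_bound_0 [simp]: "step2_bound q 0 = step1_bound q d"
  by (simp add: step2_bound_def)

lemma step2_bound_Suc: "step2_bound q (Suc j) = 64 * M ^ 3 * Z * step2_bound q j"
  by (simp add: step2_bound_def)

lemma step1_bound_ge: "0 \<le> q \<Longrightarrow> q \<le> step1_bound q i"
  using step1_bound_mono[of q 0 i] by simp

lemma step2_bound_mono: "0 \<le> q \<Longrightarrow> i \<le> j \<Longrightarrow> step2_bound q i \<le> step2_bound q j"
  unfolding step2_bound_def using growth_factors step1_bound_ge[of q d] 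
  by (intro mult_right_mono power_increasing) auto

lemma step2_bound_ge: "0 \<le> q \<Longrightarrow> q \<le> step2_bound q i"
  using step2_bound_mono[of q 0 i] step1_bound_ge[of q d] by simp

lemma alpha_eq: "\<alpha> * q = 4 * step2_bound q d"
  by (simp add: \<alpha>_def alarm_factor_def step2_bound_def step1_bound_def Z_def)

lemma alpha_ge: "4 \<le> \<alpha>"
  using step2_bound_ge[of 1 d] alpha_eq[of 1] by simp

lemma step2_bound_le_alpha: "0 \<le> q \<Longrightarrow> j \<le> d \<Longrightarrow> step2_bound q j \<le> \<alpha> * q"
  using step2_bound_mono[of q j d] step2_bound_ge[of q d] by (simp add: alpha_eq)

lemma step1_bound_le_alpha: "0 \<le> q \<Longrightarrow> i \<le> d \<Longrightarrow> step1_bound q i \<le> \<alpha> * q"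
  using step1_bound_mono[of q i d] step2_bound_le_alpha[of q 0] by simp

lemma lam_eq: "lam M (1 / Z) q i = M * Z * step1_bound q i"
proof -
  have "(4::real) ^ (2 * i) = 16 ^ i" "M ^ (2 * i) = (M\<^sup>2) ^ i"
    by (auto simp: power_mult)
  then show ?thesis
    using Z_bounds(6) by (simp add: lam_def step1_bound_def power_mult_distrib power_one_over)
qed

lemma xi_eq: "xi d M (1 / Z) q j = M\<^sup>2 * Z * step2_bound q j"
proof -
  have "(4::real) ^ (3 * j) = 64 ^ j" "M ^ (3 * j) = (M ^ 3) ^ j" 
       "(4::real) ^ (2 * d) = 16 ^ d" "M ^ (2 * d) = (M\<^sup>2) ^ d"
    by (auto simp: power_mult)
  then show ?thesis
    using Z_bounds(6)
    by (simp add: xi_def q_prime_def step1_bound_def step2_bound_def power_mult_distrib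
        power_one_over power2_eq_square)
qed

text \<open>The second bound is for probes, where \<open>A x\<^sub>t\<close> is part of the error; the first for the uncontrolled
  steps of Step 2, where \<open>A x\<^sub>t\<close> is the signal.\<close>
lemma drift_bound:
  assumes "bounded_misspec t" "driven t u" and u: "u \<in> carrier_vec d"
  shows "l2_norm (X (Suc t) - (A *\<^sub>v X t + B *\<^sub>v u)) \<le> h * N t + F"
    and "l2_norm (X (Suc t) - B *\<^sub>v u) \<le> (M + h) * N t + F"
proof -
  have t: "1 \<le> t" "t < T" using assms by (auto simp: bounded_misspec_def)
  have AX: "A *\<^sub>v X t \<in> carrier_vec d" and Bu: "B *\<^sub>v u \<in> carrier_vec d"
    using mult_mat_vec_carrier[OF A X] mult_mat_vec_carrier[OF B u] .
  have Wf: "l2_norm (W t + f t) \<le> h * N t + F"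
    using l2_norm_triangle[OF W f, of t t] norm_W_le[OF assms(1)] norm_f_le[OF t(2)] by linarith
  have "X (Suc t) - (A *\<^sub>v X t + B *\<^sub>v u) = W t + f t"
    unfolding assms(2)[unfolded driven_def] by (rule vec_cancel(1)[OF AX Bu W f])
  then show "l2_norm (X (Suc t) - (A *\<^sub>v X t + B *\<^sub>v u)) \<le> h * N t + F"
    using Wf by simp
  have "l2_norm (A *\<^sub>v X t) \<le> M * l2_norm (X t)" by (rule op_boundD[OF A_bound A X])
  also have "\<dots> \<le> M * N t" using M_ge norm_X_le[OF t(1)] by (simp add: mult_left_mono)
  finally have AXn: "l2_norm (A *\<^sub>v X t) \<le> M * N t" .
  have "X (Suc t) - B *\<^sub>v u = A *\<^sub>v X t + (W t + f t)"
    unfolding assms(2)[unfolded driven_def] by (rule vec_cancel(2)[OF AX Bu W f])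
  then have "l2_norm (X (Suc t) - B *\<^sub>v u) \<le> l2_norm (A *\<^sub>v X t) + l2_norm (W t + f t)"
    using l2_norm_triangle[OF AX, of "W t + f t"] by simp
  then show "l2_norm (X (Suc t) - B *\<^sub>v u) \<le> (M + h) * N t + F"
    using Wf AXn by (simp add: algebra_simps)
qed

lemma norm_X_Suc_le:
  assumes "bounded_misspec t" "driven t u" and u: "u \<in> carrier_vec d"
  shows "l2_norm (X (Suc t)) \<le> M * l2_norm u + (M + h) * N t + F"
  using drift_bound(2)[OF assms] op_boundD[OF B_bound B u]
    norm_le_add_diff[OF X mult_mat_vec_carrier[OF B u], of "Suc t"] by linarith

text \<open>What holds of the budget whether or not the disturbance is negligible. The bound \<open>\<Gamma> F\<close> on \<open>q\<close> and
  the bound \<open>\<Gamma> max q F\<close> on \<open>N t\<close> together give the gain \<open>\<Gamma>\<^sup>2\<close>, and \<open>q \<le> N t\<close> makes the next budget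
  positive.\<close>
definition budget_ok :: "nat \<Rightarrow> real \<Rightarrow> bool" where
  "budget_ok t q \<longleftrightarrow> 0 < q \<and> q \<le> N t \<and> N t \<le> \<Gamma> * max q F \<and> q \<le> \<Gamma> * F"

text \<open>All controls that are ever played below the threshold have norm at most \<open>4 M / L\<close> times \<open>\<alpha> q\<close>: for the
  feedback this is \<open>\<parallel>B_hat\<^sup>-\<^sup>1\<parallel> \<parallel>A_hat\<parallel> \<le> (2 / L) (2 M)\<close>, and probing controls are not larger.\<close>
lemma budget_ok_Suc:
  assumes ad: "bounded_misspec t" and dr: "driven t u" and u: "u \<in> carrier_vec d"
    and cr: "budget_ok t q" and N_le: "N t \<le> \<alpha> * q" and un: "l2_norm u \<le> 4 * M / L * (\<alpha> * q)"
  shows "budget_ok (Suc t) q"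
proof -
  define y where "y = \<alpha> * max q F"
  have q: "0 < q" using cr by (simp add: budget_ok_def)
  have qy: "\<alpha> * q \<le> y" using alpha_ge by (simp add: y_def)
  have Fy: "F \<le> y" using mult_right_mono[of 1 \<alpha> "max q F"] alpha_ge q by (simp add: y_def)
  have y0: "0 \<le> y" using F_nonneg Fy by linarith
  (* both M and 1 are absorbed into M^2 / L, which is the size of the feedback response *)
  have M_sq_div_L: "M \<le> M\<^sup>2 / L" "1 \<le> M\<^sup>2 / L"
  proof -
    have "M * L \<le> M * M" using M_ge L_le by (intro mult_left_mono) auto
    then show "M \<le> M\<^sup>2 / L" using L_pos by (simp add: field_simps power2_eq_square)
    with M_ge show "1 \<le> M\<^sup>2 / L" by linarith
  qed
  have "M * l2_norm u \<le> M * (4 * M / L * y)"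
    using un qy M_ge L_pos
    by (intro mult_left_mono order_trans[OF un] mult_left_mono qy) auto
  also have "\<dots> = 4 * (M\<^sup>2 / L) * y" by (simp add: power2_eq_square)
  finally have 1: "M * l2_norm u \<le> 4 * (M\<^sup>2 / L) * y" .
  have Ny: "N t \<le> y" using N_le qy by linarith
  have Mh: "(M + h) * N t \<le> (M\<^sup>2 / L + 1 / 12) * y"
    using M_sq_div_L h_le_12 h_nonneg M_ge Ny y0 by (intro mult_mono) auto
  have one: "y \<le> (M\<^sup>2 / L) * y" using mult_right_mono[OF M_sq_div_L(2) y0] by simp
  have "N (Suc t) \<le> N t + l2_norm (X (Suc t))" by (rule N_Suc_le)
  also have "\<dots> \<le> y + (4 * (M\<^sup>2 / L) * y + (M\<^sup>2 / L + 1 / 12) * y + y)"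
    using norm_X_Suc_le[OF ad dr u] 1 Mh Ny Fy by linarith
  also have "\<dots> \<le> 8 * (M\<^sup>2 / L) * y" unfolding distrib_right using one y0 by linarith
  also have "\<dots> = \<Gamma> * max q F" by (simp add: \<Gamma>_def y_def)
  finally have "N (Suc t) \<le> \<Gamma> * max q F" .
  moreover have "q \<le> N (Suc t)" using cr N_mono[of t "Suc t"] by (simp add: budget_ok_def)
  ultimately show ?thesis using cr by (simp add: budget_ok_def)
qed

lemma Gamma_ge: "1 \<le> \<Gamma>"
proof -
  have "1 * 4 \<le> (8 * M\<^sup>2) * \<alpha>" using alpha_ge one_le_power[OF M_ge, of 2] by (intro mult_mono) linarith+
  then have "L \<le> 8 * M\<^sup>2 * \<alpha>" using L_le by linarith
  then show ?thesis using L_pos by (simp add: \<Gamma>_def)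
qed

section \<open>Accuracy of the estimates\<close>
abbreviation probe1 :: "real \<Rightarrow> nat \<Rightarrow> real" where "probe1 \<equiv> lam M (1 / Z)"

abbreviation probe2 :: "real \<Rightarrow> nat \<Rightarrow> real" where "probe2 \<equiv> xi d M (1 / Z)"

lemma M_sq_Z: "M \<le> M\<^sup>2 * Z" "1 \<le> M\<^sup>2 * Z" "M\<^sup>2 \<le> M ^ 3" "M \<le> M ^ 3"
proof -
  have "M * 1 \<le> M * (M * Z)" using M_ge Z_bounds(1) mult_mono[of 1 M 1 Z] by (intro mult_left_mono) auto
  then show "M \<le> M\<^sup>2 * Z" by (simp add: power2_eq_square mult.assoc)
  with M_ge show "1 \<le> M\<^sup>2 * Z" by linarith
  show "M\<^sup>2 \<le> M ^ 3" using M_ge by (intro power_increasing) auto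
  show "M \<le> M ^ 3" using power_increasing[of 1 3 M] M_ge by simp
qed

lemma col_bound:
  assumes "D \<in> carrier_mat d d" "op_bound M D" "i < d"
  shows "l2_norm (col D i) \<le> M"
  using op_boundD[OF assms(2,1), of "unit_vec d i"] assms by (simp add: mult_mat_unit_vec l2_norm_unit_vec)

text \<open>The drift is at most \<open>3 M\<close> times \<open>step1_bound q i\<close> (the disturbance being at most \<open>q\<close>), and the
  amplitude is \<open>M Z\<close> times it; the quotient is \<open>3 / Z\<close>.\<close>
lemma step1_estimate:
  assumes ad: "bounded_misspec t" and dr: "driven t (probe1 q i \<cdot>\<^sub>v unit_vec d i)"
    and i: "i < d" and q: "0 < q" and F: "F \<le> q" and Nt: "N t \<le> step1_bound q i"
  shows "l2_norm ((1 / probe1 q i) \<cdot>\<^sub>v X (Suc t) - col B i) \<le> 3 / Z"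
    and "N (Suc t) \<le> step1_bound q (Suc i)"
proof -
  define n where "n = step1_bound q i"
  have n: "q \<le> n" "0 < n" using step1_bound_ge[of q i] q by (auto simp: n_def)
  have lm: "probe1 q i = M * Z * n" by (simp add: lam_eq n_def)
  have lpos: "0 < probe1 q i" using M_ge Z_bounds(6) n by (simp add: lm)
  have cB: "col B i \<in> carrier_vec d" by (rule col_carrier_vec[OF i B])
  have Bu: "B *\<^sub>v (probe1 q i \<cdot>\<^sub>v unit_vec d i) = probe1 q i \<cdot>\<^sub>v col B i"
    using mult_mat_vec[OF B, of "unit_vec d i"] mult_mat_unit_vec[OF B i] by simp
  have Nn: "N t \<le> n" using Nt by (simp add: n_def)
  have "l2_norm (X (Suc t) - probe1 q i \<cdot>\<^sub>v col B i) \<le> (M + h) * N t + F"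
    using drift_bound(2)[OF ad dr] by (simp add: Bu)
  also have "(M + h) * N t \<le> (M + 1 / 12) * n"
    using h_le_12 h_nonneg M_ge Nn n by (intro mult_mono) auto
  also have "(M + 1 / 12) * n + F \<le> 3 * M * n"
    unfolding distrib_right using mult_right_mono[OF M_ge, of n] n F by linarith
  finally have dist: "l2_norm (X (Suc t) - probe1 q i \<cdot>\<^sub>v col B i) \<le> 3 * M * n" by simp
  then show "l2_norm ((1 / probe1 q i) \<cdot>\<^sub>v X (Suc t) - col B i) \<le> 3 / Z"
    using Z_bounds(6) by (intro l2_norm_rescale[OF X cB lpos]) (simp add: lm)
  have "l2_norm (probe1 q i \<cdot>\<^sub>v col B i) \<le> probe1 q i * M"
    using lpos col_bound[OF B B_bound i] by (simp add: l2_norm_smult mult_left_mono)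
  then have "l2_norm (X (Suc t)) \<le> M\<^sup>2 * Z * n + 3 * M * n"
    using norm_le_add_diff[OF X, of "probe1 q i \<cdot>\<^sub>v col B i" "Suc t"] cB dist
    by (simp add: lm power2_eq_square algebra_simps)
  then have "N (Suc t) \<le> n + M\<^sup>2 * Z * n + 3 * M * n"
    using N_Suc_le[of t] Nn by linarith
  also have "\<dots> \<le> 16 * M\<^sup>2 * Z * n"
    using mult_right_mono[OF M_sq_Z(1), of n] mult_right_mono[OF M_sq_Z(2), of n] n
    by linarith
  finally show "N (Suc t) \<le> step1_bound q (Suc i)"
    by (simp add: step1_bound_Suc n_def)
qed

text \<open>What the controller verifies before it inverts an estimate of \<open>B\<close>. It therefore holds in Step 2 even
  if the estimate is spoiled by the disturbance, and bounds the controls played there.\<close>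
definition invertible_estimate :: "real mat \<Rightarrow> bool" where
  "invertible_estimate Bh \<longleftrightarrow> Bh \<in> carrier_mat d d \<and>
     (\<forall>v \<in> carrier_vec d. L / 2 * l2_norm v \<le> l2_norm (Bh *\<^sub>v v))"

lemma invertible_estimateD:
  assumes "invertible_estimate Bh"
  shows "inv_mat Bh \<in> carrier_mat d d" "Bh * inv_mat Bh = 1\<^sub>m d" "op_bound (2 / L) (inv_mat Bh)"
  using inv_mat_of_bounded_below[of Bh d "L / 2"] assms L_pos
  by (auto simp: invertible_estimate_def)

lemma Z_ge_sqrt_d: "1024 * sqrt (real d) \<le> Z"
proof -
  have "1024 * 1 * sqrt (real d) \<le> 1024 * M * sqrt (real d)" 
    using M_ge by (intro mult_right_mono mult_left_mono) auto
  moreover have "Z * L \<le> Z * 1" using L_le Z_bounds(6) by (intro mult_left_mono) auto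
  ultimately show ?thesis using Z_bounds(2) by linarith
qed

text \<open>\<open>1 - B B_hat\<^sup>-\<^sup>1 = (B_hat - B) B_hat\<^sup>-\<^sup>1\<close>, of norm at most \<open>(3 \<surd>d / Z) (2 / L) = 6 / (1024 M \<surd>d)\<close>.\<close>
lemma B_inv_close:
  assumes "invertible_estimate Bh" and close: "op_bound (3 / Z * sqrt (real d)) (Bh - B)"
  shows "op_bound (1 / (160 * M * sqrt (real d))) (1\<^sub>m d - B * inv_mat Bh)"
proof -
  note I = invertible_estimateD[OF assms(1)]
  have Bh: "Bh \<in> carrier_mat d d" using assms(1) by (simp add: invertible_estimate_def)
  have eq: "(Bh - B) * inv_mat Bh = 1\<^sub>m d - B * inv_mat Bh"
    using minus_mult_distrib_mat[OF Bh B I(1)] I(2) by simp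
  have bound: "op_bound (3 / Z * sqrt (real d) * (2 / L)) ((Bh - B) * inv_mat Bh)"
    using Z_bounds(6) by (intro op_bound_mult[OF minus_carrier_mat[OF B] I(1) close I(3)]) auto
  have small: "3 / Z * sqrt (real d) * (2 / L) \<le> 1 / (160 * M * sqrt (real d))"
  proof -
    have ZL: "Z * L = 1024 * M * real d" using L_pos by (simp add: Z_def probe_ratio_def)
    have "3 / Z * sqrt (real d) * (2 / L) = 6 * sqrt (real d) / (Z * L)" by simp
    also have "\<dots> = 6 / (1024 * M * sqrt (real d))"
      unfolding ZL using d_pos M_ge by (simp add: field_simps)
    also have "\<dots> \<le> 1 / (160 * M * sqrt (real d))"
      using d_pos M_ge by (simp add: field_simps)
    finally show ?thesis .
  qed
  show ?thesis unfolding eq[symmetric] by (rule op_bound_mono[OF bound small])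
qed

lemma step2_bound_pos: "0 < q \<Longrightarrow> 0 < step2_bound q j"
  using step2_bound_ge[of q j] by simp

lemma xi_pos: "0 < q \<Longrightarrow> 0 < probe2 q j"
  using M_ge Z_bounds(6) step2_bound_pos by (simp add: xi_eq)

lemma step2_bound_le_xi:
  assumes "0 < q"
  shows "M * step2_bound q j \<le> probe2 q j / (1024 * M * sqrt (real d))" 
    and "step2_bound q j \<le> probe2 q j / 1024"
    and "step2_bound q j \<le> probe2 q j / (1024 * sqrt (real d))"
proof -
  define m where "m = step2_bound q j"
  have m: "0 < m" using step2_bound_pos[OF assms] by (simp add: m_def)
  have "M\<^sup>2 * (1024 * sqrt (real d)) * m \<le> M\<^sup>2 * Z * m"
    using Z_ge_sqrt_d m by (intro mult_right_mono mult_left_mono) auto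
  then have *: "M\<^sup>2 * (1024 * sqrt (real d)) * m \<le> probe2 q j" by (simp add: xi_eq m_def)
  then show a: "M * step2_bound q j \<le> probe2 q j / (1024 * M * sqrt (real d))"
    using M_ge d_pos by (simp add: m_def[symmetric] field_simps power2_eq_square)
  have "1 * (1024 * sqrt (real d)) * m \<le> M\<^sup>2 * (1024 * sqrt (real d)) * m"
    using m M_ge by (intro mult_right_mono) auto
  with * have b: "1024 * sqrt (real d) * m \<le> probe2 q j" by linarith
  then show "step2_bound q j \<le> probe2 q j / (1024 * sqrt (real d))"
    using d_pos by (simp add: m_def[symmetric] field_simps)
  have "1024 * 1 * m \<le> 1024 * sqrt (real d) * m"
    using sqrt_d_ge m by (intro mult_right_mono mult_left_mono) auto
  with b show "step2_bound q j \<le> probe2 q j / 1024" by (simp add: m_def)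
qed

text \<open>The state reached differs from \<open>\<xi>\<^sub>j e\<^sub>j\<close> by the drift and by \<open>\<xi>\<^sub>j (B B_hat\<^sup>-\<^sup>1 - 1) e\<^sub>j\<close>. The factor
  \<open>1 / (M \<surd>d)\<close> in the error is needed since this state is next multiplied by \<open>A\<close> and the resulting
  column errors are collected into a matrix.\<close>
lemma step2_probe_estimate:
  assumes ad: "bounded_misspec t"
    and dr: "driven t (probe2 q j \<cdot>\<^sub>v (inv_mat Bh *\<^sub>v unit_vec d j))"
    and j: "j < d" and q: "0 < q" and F: "F \<le> q" and Nt: "N t \<le> step2_bound q j"
    and Bh: "invertible_estimate Bh" "op_bound (3 / Z * sqrt (real d)) (Bh - B)"
  shows "l2_norm (X (Suc t) - probe2 q j \<cdot>\<^sub>v unit_vec d j) \<le> probe2 q j / (100 * M * sqrt (real d))"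
    and "N (Suc t) \<le> 51 / 50 * probe2 q j"
proof -
  define m where "m = step2_bound q j"
  define x where "x = probe2 q j"
  define J where "J = inv_mat Bh"
  have J: "J \<in> carrier_mat d d" using invertible_estimateD[OF Bh(1)] by (simp add: J_def)
  have m: "q \<le> m" "0 < m" using step2_bound_ge[of q j] q by (auto simp: m_def)
  have x: "0 < x" using xi_pos[OF q] by (simp add: x_def)
  have e: "unit_vec d j \<in> carrier_vec d" by simp
  have BJe: "B *\<^sub>v (J *\<^sub>v unit_vec d j) \<in> carrier_vec d"
    using mult_mat_vec_carrier[OF B mult_mat_vec_carrier[OF J e]] .
  have Bu: "B *\<^sub>v (x \<cdot>\<^sub>v (J *\<^sub>v unit_vec d j)) = x \<cdot>\<^sub>v (B *\<^sub>v (J *\<^sub>v unit_vec d j))"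
    using mult_mat_vec[OF B mult_mat_vec_carrier[OF J e]] .
  have Nm: "N t \<le> m" using Nt by (simp add: m_def)
  have "l2_norm (X (Suc t) - x \<cdot>\<^sub>v (B *\<^sub>v (J *\<^sub>v unit_vec d j))) \<le> (M + h) * N t + F"
    using drift_bound(2)[OF ad dr] J Bu by (simp add: x_def J_def)
  also have "(M + h) * N t \<le> (M + 1 / 12) * m"
    using h_le_12 h_nonneg M_ge Nm m by (intro mult_mono) auto
  also have "(M + 1 / 12) * m + F \<le> 3 * (M * m)"
    unfolding distrib_right using mult_right_mono[OF M_ge, of m] m F by linarith
  finally have 1: "l2_norm (X (Suc t) - x \<cdot>\<^sub>v (B *\<^sub>v (J *\<^sub>v unit_vec d j))) \<le> 3 * (x / (1024 * M * sqrt (real d)))"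
    using step2_bound_le_xi(1)[OF q, of j] by (simp add: m_def x_def)
  have "x \<cdot>\<^sub>v (B *\<^sub>v (J *\<^sub>v unit_vec d j)) - x \<cdot>\<^sub>v unit_vec d j
      = (- x) \<cdot>\<^sub>v ((1\<^sub>m d - B * J) *\<^sub>v unit_vec d j)"
  proof -
    have "(1\<^sub>m d - B * J) *\<^sub>v unit_vec d j = unit_vec d j - B *\<^sub>v (J *\<^sub>v unit_vec d j)"
      unfolding minus_mult_distrib_mat_vec[OF one_carrier_mat mult_carrier_mat[OF B J] e]
        assoc_mult_mat_vec[OF B J e] by simp
    then show ?thesis using BJe by (intro eq_vecI) (auto simp: algebra_simps)
  qed
  then have "l2_norm (x \<cdot>\<^sub>v (B *\<^sub>v (J *\<^sub>v unit_vec d j)) - x \<cdot>\<^sub>v unit_vec d j)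
      = x * l2_norm ((1\<^sub>m d - B * J) *\<^sub>v unit_vec d j)"
    using x by (simp only: l2_norm_smult abs_minus_cancel abs_of_pos)
  moreover have "l2_norm ((1\<^sub>m d - B * J) *\<^sub>v unit_vec d j) \<le> 1 / (160 * M * sqrt (real d))"
    using op_boundD[OF B_inv_close[OF Bh, folded J_def] minus_carrier_mat[OF mult_carrier_mat[OF B J]] e] j
    by (simp add: l2_norm_unit_vec)
  ultimately have 2: "l2_norm (x \<cdot>\<^sub>v (B *\<^sub>v (J *\<^sub>v unit_vec d j)) - x \<cdot>\<^sub>v unit_vec d j)
      \<le> x * (1 / (160 * M * sqrt (real d)))"
    using x by (metis less_imp_le mult_left_mono)
  have "l2_norm (X (Suc t) - x \<cdot>\<^sub>v unit_vec d j)
      \<le> 3 * (x / (1024 * M * sqrt (real d))) + x * (1 / (160 * M * sqrt (real d)))"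
    using l2_norm_dist_triangle[OF X, of "x \<cdot>\<^sub>v (B *\<^sub>v (J *\<^sub>v unit_vec d j))" "x \<cdot>\<^sub>v unit_vec d j" "Suc t"]
      BJe 1 2 by simp
  also have "\<dots> \<le> x / (100 * M * sqrt (real d))"
    using x M_ge d_pos by (simp add: field_simps)
  finally have 3: "l2_norm (X (Suc t) - x \<cdot>\<^sub>v unit_vec d j) \<le> x / (100 * M * sqrt (real d))" .
  then show "l2_norm (X (Suc t) - probe2 q j \<cdot>\<^sub>v unit_vec d j) \<le> probe2 q j / (100 * M * sqrt (real d))"
    by (simp add: x_def)
  have "1 * 1 \<le> M * sqrt (real d)" using M_ge sqrt_d_ge by (intro mult_mono) auto
  then have "x / (100 * M * sqrt (real d)) \<le> x / 100"
    using x by (intro divide_left_mono) auto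
  moreover have "l2_norm (x \<cdot>\<^sub>v unit_vec d j) = x" using x j by (simp add: l2_norm_smult l2_norm_unit_vec)
  ultimately have "l2_norm (X (Suc t)) \<le> x + x / 100"
    using norm_le_add_diff[OF X, of "x \<cdot>\<^sub>v unit_vec d j" "Suc t"] 3 by simp
  then show "N (Suc t) \<le> 51 / 50 * probe2 q j"
    using N_Suc_le[of t] Nm step2_bound_le_xi(2)[OF q, of j] x by (simp add: m_def x_def)
qed

text \<open>The error has three parts, relative to \<open>\<xi>\<^sub>j / \<surd>d\<close>: the misspecification contributes
  \<open>h \<surd>d\<close> times \<open>51/50\<close>, at most \<open>51/600\<close>; the deviation of the current state from \<open>\<xi>\<^sub>j e\<^sub>j\<close>
  contributes \<open>1/100\<close>; the disturbance contributes \<open>1/1024\<close>. Their sum is below \<open>1/6\<close>.\<close>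
lemma step2_response_estimate:
  assumes ad: "bounded_misspec t" and dr: "driven t (0\<^sub>v d)"
    and j: "j < d" and q: "0 < q" and F: "F \<le> q" and Nt: "N t \<le> 51 / 50 * probe2 q j"
    and Xt: "l2_norm (X t - probe2 q j \<cdot>\<^sub>v unit_vec d j) \<le> probe2 q j / (100 * M * sqrt (real d))"
  shows "l2_norm ((1 / probe2 q j) \<cdot>\<^sub>v X (Suc t) - col A j) \<le> 1 / (6 * sqrt (real d))"
    and "N (Suc t) \<le> step2_bound q (Suc j)"
proof -
  define m where "m = step2_bound q j"
  define x where "x = probe2 q j"
  define sd where "sd = sqrt (real d)"
  have sd: "1 \<le> sd" using sqrt_d_ge by (simp add: sd_def)
  have m: "q \<le> m" "0 < m" using step2_bound_ge[of q j] q by (auto simp: m_def)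
  have x: "0 < x" using xi_pos[OF q] by (simp add: x_def)
  have e: "x \<cdot>\<^sub>v unit_vec d j \<in> carrier_vec d" by simp
  have cA: "col A j \<in> carrier_vec d" by (rule col_carrier_vec[OF j A])
  have AX: "A *\<^sub>v X t \<in> carrier_vec d" using mult_mat_vec_carrier[OF A X] .
  have "B *\<^sub>v 0\<^sub>v d = 0\<^sub>v d" using B by (intro eq_vecI) auto
  then have AX0: "A *\<^sub>v X t + B *\<^sub>v 0\<^sub>v d = A *\<^sub>v X t" using AX by simp
  have Fx: "F \<le> x / (1024 * sd)"
    using step2_bound_le_xi(3)[OF q, of j] F m by (simp add: m_def x_def sd_def)
  have "h * N t \<le> 1 / (12 * sd) * (51 / 50 * x)"
    using h_le h_nonneg Nt x sd by (intro mult_mono) (auto simp: sd_def x_def)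
  then have 1: "l2_norm (X (Suc t) - A *\<^sub>v X t) \<le> 1 / (12 * sd) * (51 / 50 * x) + x / (1024 * sd)"
    using drift_bound(1)[OF ad dr] Fx by (simp add: AX0)
  have "A *\<^sub>v X t - x \<cdot>\<^sub>v col A j = A *\<^sub>v (X t - x \<cdot>\<^sub>v unit_vec d j)"
    using mult_minus_distrib_mat_vec[OF A X e, of t] mult_mat_vec[OF A, of "unit_vec d j"]
      mult_mat_unit_vec[OF A j] by simp
  then have "l2_norm (A *\<^sub>v X t - x \<cdot>\<^sub>v col A j) \<le> M * l2_norm (X t - x \<cdot>\<^sub>v unit_vec d j)"
    using op_boundD[OF A_bound A, of "X t - x \<cdot>\<^sub>v unit_vec d j"] X[of t] e by simp
  also have "\<dots> \<le> M * (x / (100 * M * sd))"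
    using Xt M_ge by (intro mult_left_mono) (auto simp: x_def sd_def)
  also have "\<dots> = x / (100 * sd)" using M_ge by simp
  finally have 2: "l2_norm (A *\<^sub>v X t - x \<cdot>\<^sub>v col A j) \<le> x / (100 * sd)" .
  have "l2_norm (X (Suc t) - x \<cdot>\<^sub>v col A j)
      \<le> 1 / (12 * sd) * (51 / 50 * x) + x / (1024 * sd) + x / (100 * sd)"
    using l2_norm_dist_triangle[OF X AX, of "x \<cdot>\<^sub>v col A j" "Suc t"] cA 1 2 by simp
  also have "\<dots> \<le> 1 / (6 * sd) * x" using sd x by (simp add: field_simps)
  finally have 3: "l2_norm (X (Suc t) - x \<cdot>\<^sub>v col A j) \<le> 1 / (6 * sd) * x" .
  then show "l2_norm ((1 / probe2 q j) \<cdot>\<^sub>v X (Suc t) - col A j) \<le> 1 / (6 * sqrt (real d))"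
    using x by (intro l2_norm_rescale[OF X cA]) (auto simp: x_def sd_def)
  (* the crude bound |X (Suc t)| <= (M + 1) xi suffices for the norm of the past: a factor 16 is left *)
  have "1 / (6 * sd) * x \<le> x" using sd x by (simp add: field_simps)
  moreover have "l2_norm (x \<cdot>\<^sub>v col A j) \<le> x * M"
    using x col_bound[OF A A_bound j] by (simp add: l2_norm_smult mult_left_mono)
  ultimately have "l2_norm (X (Suc t)) \<le> x * M + x"
    using norm_le_add_diff[OF X iffD2[OF smult_carrier_vec cA], of "Suc t" x] 3 by linarith
  then have "N (Suc t) \<le> 51 / 50 * x + x * M + x"
    using N_Suc_le[of t] Nt by (simp add: x_def)
  also have "\<dots> \<le> 4 * M * x" using mult_right_mono[OF M_ge, of x] x by (simp add: algebra_simps)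
  also have "\<dots> = 4 * (M ^ 3 * Z * m)" by (simp add: x_def xi_eq m_def power2_eq_square power3_eq_cube)
  also have "\<dots> \<le> 64 * (M ^ 3 * Z * m)" using M_ge Z_bounds(6) m by (intro mult_right_mono) auto
  finally show "N (Suc t) \<le> step2_bound q (Suc j)" by (simp add: step2_bound_Suc m_def)
qed

text \<open>With \<open>J = B_hat\<^sup>-\<^sup>1\<close> one has \<open>A - B J A_hat = (A - A_hat) + (1 - B J) A_hat\<close>, of norm at most
  \<open>1/6 + 1/12\<close>.\<close>
lemma estimated_feedback_contracts:
  assumes Bh: "invertible_estimate Bh" "op_bound (3 / Z * sqrt (real d)) (Bh - B)"
    and Ah: "Ah \<in> carrier_mat d d" "op_bound (1 / 6) (Ah - A)" "op_bound (2 * M) Ah"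
  shows "op_bound (1 / 4) (A - B * (inv_mat Bh * Ah))"
proof -
  define J where "J = inv_mat Bh"
  have J: "J \<in> carrier_mat d d" using invertible_estimateD[OF Bh(1)] by (simp add: J_def)
  have BJ: "B * J \<in> carrier_mat d d" using mult_carrier_mat[OF B J] .
  have BJA: "B * J * Ah \<in> carrier_mat d d" using mult_carrier_mat[OF BJ Ah(1)] .
  have R: "1\<^sub>m d - B * J \<in> carrier_mat d d" by (rule minus_carrier_mat[OF BJ])
  have "op_bound (1 / (160 * M * sqrt (real d)) * (2 * M)) ((1\<^sub>m d - B * J) * Ah)"
    using M_ge by (intro op_bound_mult[OF R Ah(1) _ Ah(3)] B_inv_close[OF Bh, folded J_def]) auto
  moreover have "1 / (160 * M * sqrt (real d)) * (2 * M) \<le> 1 / 12"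
  proof -
    have "1 / (160 * M * sqrt (real d)) * (2 * M) = 1 / (80 * sqrt (real d))" using M_ge by simp
    also have "\<dots> \<le> 1 / 12" using sqrt_d_ge by (intro divide_left_mono) (linarith | simp)+
    finally show ?thesis .
  qed
  ultimately have 1: "op_bound (1 / 12) ((1\<^sub>m d - B * J) * Ah)" by (rule op_bound_mono)
  have 2: "(1\<^sub>m d - B * J) * Ah = Ah - B * J * Ah"
    using minus_mult_distrib_mat[OF one_carrier_mat BJ Ah(1)] Ah(1) by simp
  have 3: "A - B * (J * Ah) = - (Ah - A) + (Ah - B * J * Ah)"
    unfolding assoc_mult_mat[OF B J Ah(1), symmetric]
    by (rule mat_minus_split[OF A Ah(1) BJA])
  have "op_bound (1 / 6 + 1 / 12) (- (Ah - A) + (Ah - B * J * Ah))"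
    by (rule op_bound_add[OF uminus_carrier_mat minus_carrier_mat[OF BJA]])
      (use minus_carrier_mat[OF A] op_bound_uminus[OF minus_carrier_mat[OF A] Ah(2)] 1 2 in auto)
  then show ?thesis unfolding 3 J_def[symmetric] by simp
qed

text \<open>The tests at the end of Step 1 and in Step 3 reject no accurate estimate. This lemma is for
  \<open>A_hat\<close>, the next for \<open>B_hat\<close>.\<close>
lemma estimate_bounds:
  assumes Ah: "Ah \<in> carrier_mat d d" "op_bound (1 / 6) (Ah - A)"
  shows "op_bound (2 * M) Ah"
proof -
  have "op_bound (M + 1 / 6) (A + (Ah - A))"
    by (rule op_bound_add[OF A minus_carrier_mat[OF A] A_bound Ah(2)])
  moreover have "A + (Ah - A) = Ah" using Ah(1) A by (intro eq_matI) auto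
  ultimately have "op_bound (M + 1 / 6) Ah" by simp
  then show ?thesis by (rule op_bound_mono) (use M_ge in simp)
qed

lemma B_estimate_below:
  assumes Bh: "Bh \<in> carrier_mat d d" "op_bound (3 / Z * sqrt (real d)) (Bh - B)"
    and v: "v \<in> carrier_vec d"
  shows "L / 2 * l2_norm v \<le> l2_norm (Bh *\<^sub>v v)"
proof -
  have "L * l2_norm v \<le> l2_norm (B *\<^sub>v v)" by (rule B_below[OF v])
  also have "\<dots> \<le> l2_norm (Bh *\<^sub>v v) + l2_norm (B *\<^sub>v v - Bh *\<^sub>v v)"
    using norm_le_add_diff[OF mult_mat_vec_carrier[OF B v] mult_mat_vec_carrier[OF Bh(1) v]] .
  also have "B *\<^sub>v v - Bh *\<^sub>v v = - ((Bh - B) *\<^sub>v v)"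
    unfolding minus_mult_distrib_mat_vec[OF Bh(1) B v]
    using vec_minus_swap[OF mult_mat_vec_carrier[OF B v] mult_mat_vec_carrier[OF Bh(1) v]] .
  also have "l2_norm (- ((Bh - B) *\<^sub>v v)) \<le> 3 / Z * sqrt (real d) * l2_norm v"
    using op_boundD[OF Bh(2) minus_carrier_mat[OF B] v] by simp
  also have "3 / Z * sqrt (real d) * l2_norm v \<le> L / 2 * l2_norm v"
  proof (rule mult_right_mono)
    have "1024 * 1 * sqrt (real d) \<le> 1024 * M * sqrt (real d)" 
      using M_ge by (intro mult_right_mono mult_left_mono) auto
    then have "1024 * sqrt (real d) \<le> Z * L" using Z_bounds(2) by linarith
    then have "6 * sqrt (real d) \<le> Z * L" by (smt (verit) sqrt_d_ge)
    then show "3 / Z * sqrt (real d) \<le> L / 2" using Z_bounds(6) by (simp add: field_simps)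
  qed simp
  finally show ?thesis by simp
qed

section \<open>The invariant of the controller\<close>
definition hist :: "nat \<Rightarrow> real vec list" where
  "hist t = map X [1..<Suc t]"

lemma length_hist [simp]: "length (hist t) = t"
  by (simp add: hist_def)

lemma l2_norm_list_hist [simp]: "l2_norm_list (hist t) = N t"
  unfolding hist_def N_def by (rule l2_norm_list_energy)

lemma obs_hist: "1 \<le> k \<Longrightarrow> k \<le> t \<Longrightarrow> obs (hist t) k = X k"
  by (simp add: obs_def hist_def nth_map del: upt_Suc)

lemma B_hat_hist:
  "s + d \<le> t \<Longrightarrow> B_hat d M \<epsilon> q s (hist t)
     = mat_of_cols d (map (\<lambda>i. (1 / lam M \<epsilon> q i) \<cdot>\<^sub>v X (s + i + 1)) [0..<d])"
  unfolding B_hat_def by (intro arg_cong[of _ _ "mat_of_cols d"] map_cong) (auto simp: obs_hist)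

lemma A_hat_hist:
  "s + 2 * d \<le> t \<Longrightarrow> A_hat d M \<epsilon> q s (hist t)
     = mat_of_cols d (map (\<lambda>j. (1 / xi d M \<epsilon> q j) \<cdot>\<^sub>v X (s + 2 * j + 2)) [0..<d])"
  unfolding A_hat_def by (intro arg_cong[of _ _ "mat_of_cols d"] map_cong) (auto simp: obs_hist)

text \<open>Meaning of the bound on the energy: after the main loop was entered with energy at most
  \<open>(\<alpha> q / 4)\<^sup>2\<close>, each squared state is at most three times the sum of the squares of its three parts,
  feedback response, misspecification and disturbance. Sums over the past, rather than a
  recursion for \<open>N t\<close>, are needed because the misspecification is bounded only in total.\<close>
definition settled :: "nat \<Rightarrow> real \<Rightarrow> real mat \<Rightarrow> bool" where
  "settled t q K \<longleftrightarrow> N t \<le> \<alpha> * q \<and> op_bound (1 / 4) (A - B * K) \<and>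
     energy X t \<le> (\<alpha> * q / 4)\<^sup>2 + 3 / 16 * energy X (t - 1) + 3 * energy W (t - 1)
       + 3 * (\<Sum>k<t. (l2_norm (f k))\<^sup>2)"

text \<open>Small gain: the energy bound has the energy itself on the right with total coefficient
  \<open>3/16 + 3 h\<^sup>2 \<le> 3/16 + 3/144 < 1\<close>, so it can be solved for the energy.\<close>
lemma settled_Suc:
  assumes bm: "bounded_misspec t" and dr: "driven t (- (K *\<^sub>v X t))"
    and K: "K \<in> carrier_mat d d" and q: "0 < q" "F \<le> q" and st: "settled t q K"
  shows "settled (Suc t) q K"
proof -
  have t: "1 \<le> t" "t < T" and Wt: "energy W t \<le> h\<^sup>2 * energy X t"
    using bm by (auto simp: bounded_misspec_def)
  obtain s where s: "t = Suc s" using t by (cases t) auto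
  have D: "A - B * K \<in> carrier_mat d d" by (rule minus_carrier_mat[OF mult_carrier_mat[OF B K]])
  have DX: "(A - B * K) *\<^sub>v X t \<in> carrier_vec d" by (rule mult_mat_vec_carrier[OF D X])
  have D4: "op_bound (1 / 4) (A - B * K)" using st by (simp add: settled_def)
  have eq: "X (Suc t) = (A - B * K) *\<^sub>v X t + W t + f t"
    using dr feedback_vec[OF A B K X, of t] by (simp add: driven_def)
  have "l2_norm (X (Suc t)) \<le> l2_norm ((A - B * K) *\<^sub>v X t) + l2_norm (W t) + l2_norm (f t)"
    unfolding eq using l2_norm_triangle[OF DX W, of t] l2_norm_triangle[OF add_carrier_vec[OF DX W] f, of t t]
    by linarith
  also have "\<dots> \<le> 1 / 4 * l2_norm (X t) + l2_norm (W t) + l2_norm (f t)"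
    using op_boundD[OF D4 D X] by simp
  finally have "(l2_norm (X (Suc t)))\<^sup>2 \<le> (1 / 4 * l2_norm (X t) + l2_norm (W t) + l2_norm (f t))\<^sup>2"
    by (intro power_mono) auto
  also have "\<dots> \<le> 3 * ((1 / 4 * l2_norm (X t))\<^sup>2 + (l2_norm (W t))\<^sup>2 + (l2_norm (f t))\<^sup>2)"
    by (rule sum3_sq_le)
  finally have step: "(l2_norm (X (Suc t)))\<^sup>2
      \<le> 3 / 16 * (l2_norm (X t))\<^sup>2 + 3 * (l2_norm (W t))\<^sup>2 + 3 * (l2_norm (f t))\<^sup>2"
    by (simp add: power_mult_distrib power2_eq_square)
  have e: "energy X (Suc t) \<le> (\<alpha> * q / 4)\<^sup>2 + 3 / 16 * energy X t + 3 * energy W t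
       + 3 * (\<Sum>k<Suc t. (l2_norm (f k))\<^sup>2)"
  proof -
    have "energy X t \<le> (\<alpha> * q / 4)\<^sup>2 + 3 / 16 * energy X s + 3 * energy W s
        + 3 * (\<Sum>k<t. (l2_norm (f k))\<^sup>2)"
      using st by (simp add: settled_def s del: sum.lessThan_Suc)
    moreover have "energy X t = energy X s + (l2_norm (X t))\<^sup>2" "energy W t = energy W s + (l2_norm (W t))\<^sup>2"
      by (simp_all add: s energy_Suc)
    moreover have "(\<Sum>k<Suc t. (l2_norm (f k))\<^sup>2) = (\<Sum>k<t. (l2_norm (f k))\<^sup>2) + (l2_norm (f t))\<^sup>2"
      by simp
    ultimately show ?thesis using step energy_Suc[of X t] by linarith
  qed
  define a where "a = (\<alpha> * q)\<^sup>2"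
  have "(\<Sum>k<Suc t. (l2_norm (f k))\<^sup>2) \<le> (\<Sum>k<T. (l2_norm (f k))\<^sup>2)"
    using t by (intro sum_mono2) auto
  also have "\<dots> = F\<^sup>2" by (simp add: F_def sum_nonneg)
  also have "\<dots> \<le> q\<^sup>2" using q by (intro power_mono) auto
  also have "\<dots> \<le> a / 16"
  proof -
    have "4 * q \<le> \<alpha> * q" using alpha_ge q by simp
    then have "(4 * q)\<^sup>2 \<le> a" unfolding a_def using q by (intro power_mono) auto
    then show ?thesis by (simp add: power_mult_distrib)
  qed
  finally have "(\<Sum>k<Suc t. (l2_norm (f k))\<^sup>2) \<le> a / 16" .
  moreover have "energy W t \<le> 1 / 144 * energy X t"
  proof -
    have "h\<^sup>2 \<le> (1 / 12)\<^sup>2" using h_le_12 h_nonneg by (intro power_mono) auto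
    then have "h\<^sup>2 * energy X t \<le> 1 / 144 * energy X t" by (intro mult_right_mono) (auto simp: power2_eq_square)
    with Wt show ?thesis by linarith
  qed
  moreover have "energy X t \<le> energy X (Suc t)" by (rule energy_mono) simp
  moreover have "(\<alpha> * q / 4)\<^sup>2 = a / 16" by (simp add: a_def power_divide)
  moreover have "0 \<le> a" by (simp add: a_def)
  ultimately have "energy X (Suc t) \<le> a" using e by linarith
  then have "N (Suc t) \<le> \<alpha> * q"
    unfolding N_def a_def using alpha_ge q by (intro real_le_lsqrt) auto
  with e D4 show ?thesis by (simp add: settled_def)
qed

text \<open>The accuracy statements are guarded by \<open>F < q\<close>. The first alternative for the main loop is the
  initial phase, before the first call of SysID. In Step 2 the state is close to a multiple of a unit
  vector at odd offsets from the start \<open>s\<close>, and a new column of \<open>A_hat\<close> is complete at even ones.\<close>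
fun invariant :: "nat \<Rightarrow> ctrl_state \<Rightarrow> bool" where
  "invariant t (Main q K) \<longleftrightarrow> K \<in> carrier_mat d d \<and>
     (q = 0 \<and> K = 0\<^sub>m d d \<and> N t \<le> F \<or>
      budget_ok t q \<and> op_bound (4 * M / L) K \<and> (F < q \<longrightarrow> settled t q K))"
| "invariant t (Step1 q s) \<longleftrightarrow> budget_ok t q \<and> s \<le> t \<and> t \<le> s + d \<and>
     (F < q \<longrightarrow> N t \<le> step1_bound q (t - s) \<and>
       (\<forall>i < t - s. l2_norm ((1 / probe1 q i) \<cdot>\<^sub>v X (s + i + 1) - col B i) \<le> 3 / Z))"
| "invariant t (Step2 q Bh s) \<longleftrightarrow> budget_ok t q \<and> invertible_estimate Bh \<and> s \<le> t \<and> t \<le> s + 2 * d \<and>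
     (F < q \<longrightarrow> op_bound (3 / Z * sqrt (real d)) (Bh - B) \<and>
       (\<forall>j. 2 * j + 2 \<le> t - s \<longrightarrow>
          l2_norm ((1 / probe2 q j) \<cdot>\<^sub>v X (s + 2 * j + 2) - col A j) \<le> 1 / (6 * sqrt (real d))) \<and>
       (\<forall>j. t - s = 2 * j \<longrightarrow> N t \<le> step2_bound q j) \<and>
       (\<forall>j. t - s = 2 * j + 1 \<longrightarrow> N t \<le> 51 / 50 * probe2 q j \<and>
          l2_norm (X t - probe2 q j \<cdot>\<^sub>v unit_vec d j) \<le> probe2 q j / (100 * M * sqrt (real d))))"

text \<open>The dynamics is a premise inside the existential quantifier, since the reaction of the system can
  only be described once the control is known.\<close>
definition good_play :: "nat \<Rightarrow> ctrl_state \<Rightarrow> bool" where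
  "good_play t c \<longleftrightarrow> (\<exists>u c'. play d M L (1 / Z) \<alpha> (hist t) c = Some (u, c') \<and>
     u \<in> carrier_vec d \<and> (driven t u \<longrightarrow> invariant (Suc t) c'))"

lemma play_Main:
  "play d M L (1 / Z) \<alpha> (hist t) (Main q K) =
     (if N t > \<alpha> * q then play d M L (1 / Z) \<alpha> (hist t) (Step1 (N t) t)
      else Some (- (K *\<^sub>v obs (hist t) t), Main q K))"
  by (subst play.simps) (simp add: Let_def)

lemma play_Step1:
  "play d M L (1 / Z) \<alpha> (hist t) (Step1 q s) =
     (if N t > \<alpha> * q then play d M L (1 / Z) \<alpha> (hist t) (Step1 (N t) t)
      else if t - s < d then Some (probe1 q (t - s) \<cdot>\<^sub>v unit_vec d (t - s), Step1 q s)
      else if sigma_min (B_hat d M (1 / Z) q s (hist t)) < L / 2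
        then play d M L (1 / Z) \<alpha> (hist t) (Step1 (N t) t)
      else play d M L (1 / Z) \<alpha> (hist t) (Step2 q (B_hat d M (1 / Z) q s (hist t)) t))"
  by (subst play.simps) (simp add: Let_def)

lemma play_Step2:
  "play d M L (1 / Z) \<alpha> (hist t) (Step2 q Bh s) =
     (if t - s < 2 * d then
        if N t > \<alpha> * q then play d M L (1 / Z) \<alpha> (hist t) (Step1 (N t) t)
        else Some (if even (t - s)
                   then probe2 q ((t - s) div 2) \<cdot>\<^sub>v (inv_mat Bh *\<^sub>v unit_vec d ((t - s) div 2))
                   else 0\<^sub>v d, Step2 q Bh s)
      else if spectral_norm (A_hat d M (1 / Z) q s (hist t)) > 2 * M
        then play d M L (1 / Z) \<alpha> (hist t) (Step1 (N t) t)
      else play d M L (1 / Z) \<alpha> (hist t) (Main q (inv_mat Bh * A_hat d M (1 / Z) q s (hist t))))"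
  by (subst play.simps) (simp add: Let_def)

lemma control_gain_ge: "0 \<le> y \<Longrightarrow> y \<le> 4 * M / L * y" "0 \<le> y \<Longrightarrow> 2 / L * y \<le> 4 * M / L * y"
proof -
  have "L \<le> 4 * M" using M_ge L_le by linarith
  then have 1: "1 \<le> 4 * M / L" "2 / L \<le> 4 * M / L"
    using L_pos M_ge by (auto simp: field_simps)
  show "0 \<le> y \<Longrightarrow> y \<le> 4 * M / L * y" using mult_right_mono[OF 1(1), of y] by simp
  show "0 \<le> y \<Longrightarrow> 2 / L * y \<le> 4 * M / L * y" using mult_right_mono[OF 1(2), of y] by simp
qed

lemma lambda_le: "0 < q \<Longrightarrow> probe1 q i \<le> step1_bound q (Suc i)"
proof -
  assume q: "0 < q"
  have "0 < step1_bound q i" using step1_bound_ge[of q i] q by linarith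
  then have "M * Z * step1_bound q i \<le> 16 * M\<^sup>2 * Z * step1_bound q i"
    using M_ge Z_bounds(6) by (intro mult_right_mono) (auto simp: power2_eq_square)
  then show ?thesis by (simp add: lam_eq step1_bound_Suc)
qed

lemma xi_le:
  assumes "0 < q" shows "51 / 50 * probe2 q j \<le> step2_bound q (Suc j)" 
proof -
  have "M\<^sup>2 * (Z * step2_bound q j) \<le> M ^ 3 * (Z * step2_bound q j)"
    using M_sq_Z Z_bounds(6) step2_bound_pos[OF assms, of j] by (intro mult_right_mono) auto
  moreover have "0 \<le> M ^ 3 * (Z * step2_bound q j)"
    using M_ge Z_bounds(6) step2_bound_pos[OF assms, of j] by simp
  ultimately show ?thesis by (simp add: xi_eq step2_bound_Suc mult.assoc)
qed

text \<open>The case of Step 1 in which a control is played. It is separated from \<open>step1_play\<close> because every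
  restart leads to it, from every position of the program.\<close>
lemma step1_probe_play:
  assumes bm: "bounded_misspec t" and iv: "invariant t (Step1 q s)"
    and le: "N t \<le> \<alpha> * q" and lt: "t - s < d"
  shows "good_play t (Step1 q s)"
proof -
  define i where "i = t - s"
  have t: "t = s + i" using iv by (simp add: i_def)
  define u where "u = probe1 q i \<cdot>\<^sub>v unit_vec d i"
  have u: "u \<in> carrier_vec d" by (simp add: u_def)
  have cr: "budget_ok t q" and q: "0 < q" using iv by (auto simp: budget_ok_def)
  have i: "i < d" using lt by (simp add: i_def)
  have "0 \<le> probe1 q i"
    using M_ge Z_bounds(6) step1_bound_ge[of q i] q by (simp add: lam_eq)
  then have "l2_norm u = probe1 q i" using i by (simp add: u_def l2_norm_smult l2_norm_unit_vec)
  also have "\<dots> \<le> \<alpha> * q"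
    using lambda_le[OF q, of i] step1_bound_le_alpha[of q "Suc i"] q i by simp
  also have "\<dots> \<le> 4 * M / L * (\<alpha> * q)" using control_gain_ge(1)[of "\<alpha> * q"] alpha_ge q by simp
  finally have un: "l2_norm u \<le> 4 * M / L * (\<alpha> * q)" .
  have "invariant (Suc t) (Step1 q s)" if dr: "driven t u"
  proof -
    have "budget_ok (Suc t) q" by (rule budget_ok_Suc[OF bm dr u cr le un])
    moreover have "N (Suc t) \<le> step1_bound q (Suc t - s) \<and>
       (\<forall>k < Suc t - s. l2_norm ((1 / probe1 q k) \<cdot>\<^sub>v X (s + k + 1) - col B k) \<le> 3 / Z)" if F: "F < q"
    proof -
      have Nt: "N t \<le> step1_bound q i" using iv F by (simp add: i_def)
      note est = step1_estimate[OF bm dr[unfolded u_def] i q _ Nt]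
      have "l2_norm ((1 / probe1 q k) \<cdot>\<^sub>v X (s + k + 1) - col B k) \<le> 3 / Z" if "k < Suc t - s" for k
      proof (cases "k = i")
        case True
        then show ?thesis using est(1) F by (simp add: t)
      next
        case False
        then show ?thesis using that iv F by (simp add: t)
      qed
      then show ?thesis using est(2) F by (simp add: t)
    qed
    ultimately show ?thesis using i by (simp add: t)
  qed
  then show ?thesis
    unfolding good_play_def play_Step1[of t q s] using le lt u by (auto simp: u_def i_def)
qed

text \<open>The dichotomy at work: if the disturbance is not negligible, the maximum in \<open>\<Gamma> max q F\<close> is \<open>F\<close>, so the
  current norm is an admissible new budget.\<close>
lemma budget_le_F: "budget_ok t q \<Longrightarrow> \<not> F < q \<Longrightarrow> 0 < N t \<and> N t \<le> \<Gamma> * F"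
  by (auto simp: budget_ok_def max_def split: if_splits)

lemma restart_play:
  assumes bm: "bounded_misspec t" and Nt: "0 < N t \<and> N t \<le> \<Gamma> * F"
  shows "good_play t (Step1 (N t) t)"
proof (rule step1_probe_play[OF bm])
  have "N t \<le> max (N t) F" by simp
  also have "\<dots> \<le> \<Gamma> * max (N t) F" 
    using mult_right_mono[OF Gamma_ge, of "max (N t) F"] Nt by (metis max.strict_coboundedI1 less_imp_le mult_1)
  finally show "invariant t (Step1 (N t) t)" using Nt by (simp add: budget_ok_def)
  show "N t \<le> \<alpha> * N t" using alpha_ge mult_right_mono[of 1 \<alpha> "N t"] by simp
qed (use d_pos in simp)

text \<open>Above the threshold, \<open>F < q\<close> is impossible as the loop would be settled; so the restart is paid for
  by the disturbance.\<close>
lemma main_play: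
  assumes bm: "bounded_misspec t" and iv: "invariant t (Main q K)"
  shows "good_play t (Main q K)"
proof (cases "N t > \<alpha> * q")
  case True
  have "0 < N t \<and> N t \<le> \<Gamma> * F"
  proof (cases "q = 0")
    case True
    have "F \<le> \<Gamma> * F" using mult_right_mono[OF Gamma_ge, of F] by simp
    moreover have "N t \<le> F" using iv True by (auto simp: budget_ok_def)
    moreover have "0 < N t" using True \<open>N t > \<alpha> * q\<close> by simp
    ultimately show ?thesis by linarith
  next
    case False
    then have "budget_ok t q" "F < q \<longrightarrow> settled t q K" using iv by auto
    then show ?thesis using \<open>N t > \<alpha> * q\<close> budget_le_F by (fastforce simp: settled_def)
  qed
  then show ?thesis
    using restart_play[OF bm] True unfolding good_play_def play_Main by simp
next
  case False
  define u where "u = - (K *\<^sub>v X t)"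
  have K: "K \<in> carrier_mat d d" using iv by simp
  have u: "u \<in> carrier_vec d" using mult_mat_vec_carrier[OF K X] by (simp add: u_def)
  have "1 \<le> t" using bm by (simp add: bounded_misspec_def)
  then have obs: "obs (hist t) t = X t" by (simp add: obs_hist)
  have "invariant (Suc t) (Main q K)" if dr: "driven t u"
  proof (cases "q = 0")
    case True
    then have K0: "K = 0\<^sub>m d d" and N0: "N t = 0"
      using iv False N_nonneg[of t] by (auto simp: budget_ok_def)
    have "K *\<^sub>v X t = 0\<^sub>v d" unfolding K0 by (intro eq_vecI) auto
    then have "l2_norm u = 0" by (simp add: u_def)
    then have "N (Suc t) \<le> F" using norm_X_Suc_le[OF bm dr u] N_Suc_le[of t] N0 by simp
    then show ?thesis using True K K0 by simp
  next
    case q0: False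
    then have cr: "budget_ok t q" and Kb: "op_bound (4 * M / L) K" and st: "F < q \<longrightarrow> settled t q K"
      using iv by auto
    have q: "0 < q" using cr by (simp add: budget_ok_def)
    have "l2_norm u \<le> 4 * M / L * l2_norm (X t)"
      using op_boundD[OF Kb K X] by (simp add: u_def)
    also have "\<dots> \<le> 4 * M / L * (\<alpha> * q)"
      using norm_X_le[OF \<open>1 \<le> t\<close>] False M_ge L_pos by (intro mult_left_mono) auto
    finally have "budget_ok (Suc t) q" using False by (intro budget_ok_Suc[OF bm dr u cr]) auto
    then show ?thesis using K Kb st settled_Suc[OF bm dr[unfolded u_def] K q] by auto
  qed
  then show ?thesis
    unfolding good_play_def play_Main using False u by (simp add: obs u_def)
qed

lemma step2_within_threshold:
  assumes iv: "invariant t (Step2 q Bh s)" and F: "F < q" and lt: "t - s < 2 * d"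
  shows "N t \<le> \<alpha> * q"
proof -
  have q: "0 < q" using iv by (auto simp: budget_ok_def)
  obtain j where "t - s = 2 * j \<or> t - s = 2 * j + 1" by (metis oddE evenE)
  then show ?thesis
  proof
    assume j: "t - s = 2 * j"
    then have "N t \<le> step2_bound q j" using iv F by simp
    then show ?thesis using step2_bound_le_alpha[of q j] j lt q by simp
  next
    assume j: "t - s = 2 * j + 1"
    then have "N t \<le> 51 / 50 * probe2 q j" using iv F by simp
    then show ?thesis using step2_bound_le_alpha[of q "Suc j"] xi_le[OF q, of j] j lt q by simp
  qed
qed

text \<open>The jump structure of the program is acyclic up to restarts: Step 1 passes to Step 2, Step 2 to the
  main loop, and any of them may restart, after which a control is played at once. This dictates the
  order of the lemmas \<open>step1_probe_play\<close>, \<open>main_play\<close>, \<open>step2_play\<close> and \<open>step1_play\<close>.\<close>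
lemma step2_play:
  assumes bm: "bounded_misspec t" and iv: "invariant t (Step2 q Bh s)"
  shows "good_play t (Step2 q Bh s)"
proof -
  have cr: "budget_ok t q" and q: "0 < q" and Bh: "invertible_estimate Bh" and st: "s \<le> t" "t \<le> s + 2 * d"
    using iv by (auto simp: budget_ok_def)
  define J where "J = inv_mat Bh"
  have J: "J \<in> carrier_mat d d" and Jb: "op_bound (2 / L) J"
    using invertible_estimateD[OF Bh] by (auto simp: J_def)
  show ?thesis
  proof (cases "t - s < 2 * d")
    case lt: True
    show ?thesis
    proof (cases "N t > \<alpha> * q")
      case True
      then have "\<not> F < q" using step2_within_threshold[OF iv _ lt] by linarith
      then have "good_play t (Step1 (N t) t)" using restart_play[OF bm] budget_le_F[OF cr] by blast
      then show ?thesis using True lt unfolding good_play_def play_Step2 by simp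
    next
      case False
      define j where "j = (t - s) div 2"
      have j: "j < d" using lt by (simp add: j_def)
      show ?thesis
      proof (cases "even (t - s)")
        case True
        then have tj: "t = s + 2 * j" using st by (simp add: j_def)
        define u where "u = probe2 q j \<cdot>\<^sub>v (J *\<^sub>v unit_vec d j)"
        have e: "unit_vec d j \<in> carrier_vec d" by simp
        have u: "u \<in> carrier_vec d" using mult_mat_vec_carrier[OF J e] by (simp add: u_def)
        have "l2_norm u = probe2 q j * l2_norm (J *\<^sub>v unit_vec d j)"
          using xi_pos[OF q, of j] by (simp add: u_def l2_norm_smult)
        also have "\<dots> \<le> probe2 q j * (2 / L)"
          using xi_pos[OF q, of j] op_boundD[OF Jb J e] j
          by (intro mult_left_mono) (auto simp: l2_norm_unit_vec)
        also have "\<dots> \<le> (\<alpha> * q) * (2 / L)"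
          using xi_le[OF q, of j] xi_pos[OF q, of j] step2_bound_le_alpha[of q "Suc j"] q j L_pos
          by (intro mult_right_mono) auto
        also have "\<dots> = 2 / L * (\<alpha> * q)" by (rule mult.commute)
        also have "\<dots> \<le> 4 * M / L * (\<alpha> * q)" using control_gain_ge(2)[of "\<alpha> * q"] alpha_ge q by simp
        finally have un: "l2_norm u \<le> 4 * M / L * (\<alpha> * q)" .
        have "invariant (Suc t) (Step2 q Bh s)" if dr: "driven t u"
        proof -
          have "budget_ok (Suc t) q" using False by (intro budget_ok_Suc[OF bm dr u cr _ un]) simp
          moreover have "N (Suc t) \<le> 51 / 50 * probe2 q j \<and>
              l2_norm (X (Suc t) - probe2 q j \<cdot>\<^sub>v unit_vec d j) \<le> probe2 q j / (100 * M * sqrt (real d))"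
            if F: "F < q"
          proof -
            have "N t \<le> step2_bound q j" "op_bound (3 / Z * sqrt (real d)) (Bh - B)"
              using iv F by (auto simp: tj)
            from step2_probe_estimate[OF bm dr[unfolded u_def J_def] j q _ this(1) Bh this(2)] F
            show ?thesis by simp
          qed
          moreover have "2 * k + 2 \<le> t - s" if "2 * k + 2 \<le> Suc t - s" for k
            using that unfolding tj by presburger
          moreover have "Suc t - s \<noteq> 2 * k" "Suc t - s = 2 * k + 1 \<longleftrightarrow> k = j" for k
            unfolding tj by presburger+
          moreover have "s \<le> Suc t" "Suc t \<le> s + 2 * d" using j by (auto simp: tj)
          ultimately show ?thesis using iv Bh by (simp del: One_nat_def)
        qed
        then show ?thesis
          unfolding good_play_def play_Step2 using False lt True u by (simp add: u_def j_def J_def)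
      next
        case odd: False
        then have tj: "t = s + 2 * j + 1" using st unfolding j_def by presburger
        have "invariant (Suc t) (Step2 q Bh s)" if dr: "driven t (0\<^sub>v d)"
        proof -
          have "l2_norm (0\<^sub>v d) \<le> 4 * M / L * (\<alpha> * q)" using M_ge L_pos alpha_ge q by simp
          then have "budget_ok (Suc t) q" using False by (intro budget_ok_Suc[OF bm dr _ cr]) auto
          moreover have "N (Suc t) \<le> step2_bound q (Suc j) \<and>
              l2_norm ((1 / probe2 q j) \<cdot>\<^sub>v X (Suc t) - col A j) \<le> 1 / (6 * sqrt (real d))"
            if F: "F < q"
          proof -
            have "N t \<le> 51 / 50 * probe2 q j" 
              "l2_norm (X t - probe2 q j \<cdot>\<^sub>v unit_vec d j) \<le> probe2 q j / (100 * M * sqrt (real d))"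
              using iv F by (auto simp: tj)
            from step2_response_estimate[OF bm dr j q _ this] F show ?thesis by simp
          qed
          moreover have "l2_norm ((1 / probe2 q k) \<cdot>\<^sub>v X (s + 2 * k + 2) - col A k) \<le> 1 / (6 * sqrt (real d))"
            if "k \<noteq> j" "2 * k + 2 \<le> Suc t - s" "F < q" for k
          proof -
            have "2 * k + 2 \<le> t - s" using that(1,2) by (simp add: tj)
            then show ?thesis using iv that(3) by simp
          qed
          moreover have "Suc t - s \<noteq> 2 * k + 1" "Suc t - s = 2 * k \<longleftrightarrow> k = Suc j" for k
            unfolding tj by presburger+
          moreover have "Suc t = s + 2 * j + 2" by (simp add: tj)
          moreover have "s \<le> Suc t" "Suc t \<le> s + 2 * d" using j by (auto simp: tj)
          ultimately show ?thesis using iv Bh unfolding invariant.simps by metis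
        qed
        then show ?thesis
          unfolding good_play_def play_Step2 using False lt odd by simp
      qed
    qed
  next
    case False
    then have t: "t = s + 2 * d" using st by simp
    define Ah where "Ah = A_hat d M (1 / Z) q s (hist t)"
    have Ah_eq: "Ah = mat_of_cols d (map (\<lambda>j. (1 / probe2 q j) \<cdot>\<^sub>v X (s + 2 * j + 2)) [0..<d])"
      unfolding Ah_def by (rule A_hat_hist) (simp add: t)
    have Ah: "Ah \<in> carrier_mat d d" by (simp add: Ah_eq carrier_matI)
    have close: "op_bound (1 / 6) (Ah - A)" if F: "F < q"
    proof -
      have "op_bound (1 / (6 * sqrt (real d)) * sqrt (real d)) (Ah - A)"
        unfolding Ah_eq using iv F by (intro op_bound_mat_of_cols_diff[OF A]) (auto simp: t)
      then show ?thesis using d_pos by simp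
    qed
    show ?thesis
    proof (cases "spectral_norm Ah > 2 * M")
      case True
      have "\<not> F < q"
      proof
        assume "F < q"
        then have "spectral_norm Ah \<le> 2 * M"
          using d_pos by (intro spectral_norm_le[OF Ah] estimate_bounds Ah close) auto
        with True show False by simp
      qed
      then have "good_play t (Step1 (N t) t)" using restart_play[OF bm] budget_le_F[OF cr] by blast
      then show ?thesis using True False unfolding good_play_def play_Step2 Ah_def by simp
    next
      case ok: False
      then have Ahb: "op_bound (2 * M) Ah"
        using op_bound_mono[OF op_bound_spectral_norm[OF Ah]] by simp
      have "op_bound (2 / L * (2 * M)) (J * Ah)"
        using L_pos by (intro op_bound_mult[OF J Ah Jb Ahb]) simp
      moreover have "settled t q (J * Ah)" if F: "F < q"
      proof -
        have Bc: "op_bound (3 / Z * sqrt (real d)) (Bh - B)" and Nt: "N t \<le> step2_bound q d"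
          using iv F by (auto simp: t)
        have "N t \<le> \<alpha> * q / 4" using Nt by (simp add: alpha_eq)
        then have "(N t)\<^sup>2 \<le> (\<alpha> * q / 4)\<^sup>2" by (intro power_mono) auto
        moreover have "0 \<le> (\<Sum>k<t. (l2_norm (f k))\<^sup>2)" by (intro sum_nonneg) simp
        moreover have "N t \<le> \<alpha> * q" using Nt step2_bound_le_alpha[of q d] q by simp
        ultimately show ?thesis
          using estimated_feedback_contracts[OF Bh Bc Ah close[OF F] Ahb]
            energy_nonneg[of X "t - 1"] energy_nonneg[of W "t - 1"]
          unfolding settled_def N_sq J_def by linarith
      qed
      ultimately have "invariant t (Main q (J * Ah))"
        using cr mult_carrier_mat[OF J Ah] by simp
      then have "good_play t (Main q (J * Ah))" by (rule main_play[OF bm])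
      then show ?thesis using False ok unfolding good_play_def play_Step2 Ah_def J_def by simp
    qed
  qed
qed

lemma step1_play:
  assumes bm: "bounded_misspec t" and iv: "invariant t (Step1 q s)"
  shows "good_play t (Step1 q s)"
proof -
  have cr: "budget_ok t q" and q: "0 < q" and st: "s \<le> t" "t \<le> s + d"
    using iv by (auto simp: budget_ok_def)
  have restart: "good_play t (Step1 (N t) t)" if "\<not> F < q"
    using restart_play[OF bm] budget_le_F[OF cr that] by blast
  show ?thesis
  proof (cases "N t > \<alpha> * q")
    case True
    have "N t \<le> \<alpha> * q" if "F < q"
    proof -
      have "N t \<le> step1_bound q (t - s)" using iv that by simp
      moreover have "step1_bound q (t - s) \<le> \<alpha> * q"
        using q st by (intro step1_bound_le_alpha) auto
      ultimately show ?thesis by linarith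
    qed
    then have "good_play t (Step1 (N t) t)" using restart True by linarith
    then show ?thesis using True unfolding good_play_def play_Step1[of t q s] by simp
  next
    case le: False
    show ?thesis
    proof (cases "t - s < d")
      case True
      then show ?thesis using step1_probe_play[OF bm iv] le by simp
    next
      case False
      then have t: "t = s + d" using st by simp
      define Bh where "Bh = B_hat d M (1 / Z) q s (hist t)"
      have Bh_eq: "Bh = mat_of_cols d (map (\<lambda>i. (1 / probe1 q i) \<cdot>\<^sub>v X (s + i + 1)) [0..<d])"
        unfolding Bh_def by (rule B_hat_hist) (simp add: t)
      have Bh: "Bh \<in> carrier_mat d d" by (simp add: Bh_eq carrier_matI)
      have close: "op_bound (3 / Z * sqrt (real d)) (Bh - B)" if F: "F < q"
        unfolding Bh_eq using iv F Z_bounds(6) by (intro op_bound_mat_of_cols_diff[OF B]) (auto simp: t)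
      show ?thesis
      proof (cases "sigma_min Bh < L / 2")
        case True
        have "L / 2 \<le> sigma_min Bh" if "F < q"
          using L_pos d_pos B_estimate_below[OF Bh close[OF that]] by (intro sigma_min_ge[OF Bh]) auto
        then have "good_play t (Step1 (N t) t)" using restart True by linarith
        then show ?thesis using True le False unfolding good_play_def play_Step1[of t q s] Bh_def by simp
      next
        case ok: False
        have "L / 2 * l2_norm v \<le> l2_norm (Bh *\<^sub>v v)" if v: "v \<in> carrier_vec d" for v
          using mult_right_mono[of "L / 2" "sigma_min Bh" "l2_norm v"] ok
            sigma_min_le[OF Bh _ v] d_pos by simp
        then have "invertible_estimate Bh" using Bh by (simp add: invertible_estimate_def)
        then have "invariant t (Step2 q Bh t)"
          using cr iv close by (simp add: t)
        then have "good_play t (Step2 q Bh t)" by (rule step2_play[OF bm])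
        then show ?thesis using ok le False unfolding good_play_def play_Step1[of t q s] Bh_def by simp
      qed
    qed
  qed
qed

lemma invariant_good_play: "bounded_misspec t \<Longrightarrow> invariant t c \<Longrightarrow> good_play t c"
  using main_play step1_play step2_play by (cases c) blast+

lemma invariant_N_le:
  assumes "invariant t c" shows "N t \<le> \<Gamma>\<^sup>2 * F"
proof -
  have G: "\<Gamma> * 1 \<le> \<Gamma> * \<Gamma>" using Gamma_ge by (intro mult_left_mono) auto
  have "1 \<le> \<Gamma> * \<Gamma>" using G Gamma_ge by linarith
  then have "1 * F \<le> \<Gamma> * \<Gamma> * F" by (intro mult_right_mono) auto
  moreover have "N t \<le> \<Gamma> * \<Gamma> * F" if "budget_ok t q" for q
  proof -
    have "max q F \<le> \<Gamma> * F"
      using that mult_right_mono[OF Gamma_ge, of F] by (simp add: budget_ok_def)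
    then have "\<Gamma> * max q F \<le> \<Gamma> * (\<Gamma> * F)" using Gamma_ge by (intro mult_left_mono) auto
    then show ?thesis using that by (simp add: budget_ok_def mult.assoc)
  qed
  ultimately show ?thesis using assms by (cases c) (auto simp: power2_eq_square)
qed

section \<open>The gain bound\<close>
text \<open>A probe of Step 1 costs a factor \<open>16 M\<^sup>2 Z \<le> Z\<^sup>4\<close> and a probe of Step 2 a factor \<open>64 M\<^sup>3 Z \<le> Z\<^sup>5\<close>, so
  \<open>\<Gamma>\<close> is at most \<open>Z\<close> to the power \<open>4 + 9 d\<close>. The generous exponent \<open>1024 d\<close> lets one constant
  serve both in the base and in the exponent of the gain.\<close>
lemma Gamma_sq_le: "\<Gamma>\<^sup>2 \<le> Z powr (1024 * real d)"
proof -
  have Z1: "1 \<le> Z" using Z_bounds(1) by linarith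
  have M0: "0 \<le> M" using M_ge by linarith
  have M2: "M\<^sup>2 \<le> Z\<^sup>2" and M3: "M ^ 3 \<le> Z ^ 3"
    using Z_bounds(4) M0 by (auto intro: power_mono)
  have "16 * M\<^sup>2 * Z \<le> Z * Z\<^sup>2 * Z"
    using M2 Z_bounds(1) by (intro mult_mono) auto
  then have a1: "16 * M\<^sup>2 * Z \<le> Z ^ 4" by (simp add: power_numeral_reduce)
  have "64 * M ^ 3 * Z \<le> Z * Z ^ 3 * Z"
    using M3 M0 Z_bounds(1) by (intro mult_mono) auto
  then have a2: "64 * M ^ 3 * Z \<le> Z ^ 5" by (simp add: power_numeral_reduce)
  have "\<Gamma> = 32 * M\<^sup>2 * (1 / L) * ((64 * M ^ 3 * Z) ^ d * (16 * M\<^sup>2 * Z) ^ d)"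
    by (simp add: \<Gamma>_def \<alpha>_def alarm_factor_def Z_def)
  also have "\<dots> \<le> Z * Z\<^sup>2 * Z * ((Z ^ 5) ^ d * (Z ^ 4) ^ d)"
    using M2 M0 Z_bounds a1 a2 L_pos
    by (intro mult_mono power_mono) (auto intro!: mult_nonneg_nonneg)
  also have "\<dots> = Z ^ (4 + 9 * d)"
  proof -
    have "Z * Z\<^sup>2 * Z = Z ^ 4" by (simp add: power_numeral_reduce)
    moreover have "(Z ^ 5) ^ d * (Z ^ 4) ^ d = Z ^ (9 * d)"
      by (simp add: power_mult[symmetric] power_add[symmetric])
    ultimately show ?thesis by (simp add: power_add)
  qed
  finally have "\<Gamma> \<le> Z ^ (4 + 9 * d)" .
  then have "\<Gamma>\<^sup>2 \<le> (Z ^ (4 + 9 * d))\<^sup>2" using Gamma_ge by (intro power_mono) auto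
  also have "\<dots> = Z ^ ((4 + 9 * d) * 2)" by (rule power_mult[symmetric])
  also have "\<dots> \<le> Z ^ (1024 * d)" using d_pos by (intro power_increasing Z1) auto
  also have "\<dots> = Z powr (1024 * real d)" using powr_realpow[OF Z_bounds(6), of "1024 * d"] by simp
  finally show ?thesis .
qed

end

lemma misspec_map:
  "misspec \<Delta> (map x [1..<Suc t]) = map (\<lambda>k. \<Delta> k (map x [1..<Suc k])) [1..<Suc t]"
  by (auto simp: misspec_def take_map min_def simp del: upt_Suc)

text \<open>The locale is instantiated with the trajectory read off from the closed loop. Outside the times that
  are reached the trajectory is set to zero, so that it is a sequence of vectors of dimension \<open>d\<close>.\<close>
lemma gain_bound:
  assumes d: "1 \<le> d" and M: "1 \<le> M" and L: "0 < L" "L \<le> 1"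
    and h: "0 \<le> h" "h \<le> 1 / (12 * sqrt (real d))"
  shows "l2_gain_le d M L h (1 / probe_ratio d M L) (alarm_factor d M L)
     (probe_ratio d M L powr (1024 * real d))"
  unfolding l2_gain_le_def
proof (intro allI impI)
  fix T :: nat and A B :: "real mat" and \<Delta> :: "nat \<Rightarrow> real vec list \<Rightarrow> real vec" and f :: "nat \<Rightarrow> real vec"
  let ?run = "closed_loop d M L (1 / probe_ratio d M L) (alarm_factor d M L) A B \<Delta> f"
  assume T: "T \<ge> 1" and A: "A \<in> carrier_mat d d" and B: "B \<in> carrier_mat d d"
    and nA: "spectral_norm A \<le> M" and nB: "spectral_norm B \<le> M" and sB: "sigma_min B > L"
    and f: "\<forall>t. f t \<in> carrier_vec d"
    and \<Delta>: "\<forall>t xs. length xs = t \<longrightarrow> set xs \<subseteq> carrier_vec d \<longrightarrow> \<Delta> t xs \<in> carrier_vec d"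
    and w: "\<forall>t xs c. 1 \<le> t \<longrightarrow> t < T \<longrightarrow> ?run t = Some (xs, c) \<longrightarrow>
          l2_norm_list (misspec \<Delta> xs) \<le> h * l2_norm_list xs"
  define X where "X t = (case ?run t of None \<Rightarrow> 0\<^sub>v d 
      | Some (xs, c) \<Rightarrow> if xs = [] then 0\<^sub>v d else last xs)" for t
  define W where "W t = \<Delta> t (map X [1..<Suc t])" for t
  have X: "X t \<in> carrier_vec d" for t
  proof (rule carrier_vecI)
    have fd: "dim_vec (f k) = d" for k using f by auto
    consider "t = 0" | "t = Suc 0" | s where "t = Suc (Suc s)" by (metis not0_implies_Suc)
    then show "dim_vec (X t) = d"
    proof cases
      case 3
      show ?thesis
      proof (cases "?run (Suc s)")
        case None
        then show ?thesis by (simp add: X_def 3)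
      next
        case (Some xc)
        obtain xs c where "xc = (xs, c)" by (cases xc)
        with Some show ?thesis
          by (cases "play d M L (1 / probe_ratio d M L) (alarm_factor d M L) xs c")
            (auto simp: X_def 3 fd)
      qed
    qed (simp_all add: X_def fd)
  qed
  have W: "W t \<in> carrier_vec d" for t
    using \<Delta>[rule_format, of "map X [1..<Suc t]" t] X by (auto simp: W_def simp del: upt_Suc)
  interpret controlled_system d M L h A B X W f T
  proof
    show "op_bound M A" "op_bound M B"
      using op_bound_mono[OF op_bound_spectral_norm[OF A] nA]
        op_bound_mono[OF op_bound_spectral_norm[OF B] nB] by blast+
    show "L * l2_norm v \<le> l2_norm (B *\<^sub>v v)" if "v \<in> carrier_vec d" for v
      using mult_right_mono[of L "sigma_min B" "l2_norm v"] sB sigma_min_le[OF B _ that] d by simp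
  qed (use d M L h A B X W f in auto)
  have reach: "\<exists>c. ?run t = Some (hist t, c) \<and> invariant t c" if "1 \<le> t" "t \<le> T" for t
    using that
  proof (induction t rule: dec_induct)
    case base
    define x where "x = A *\<^sub>v 0\<^sub>v d + B *\<^sub>v 0\<^sub>v d + 0\<^sub>v d + f 0"
    have run: "?run 1 = Some ([x], Main 0 (0\<^sub>m d d))" by (simp add: x_def)
    then have X1: "X 1 = x" by (simp add: X_def)
    have "x = f 0" unfolding x_def by (intro eq_vecI) auto
    then have "N 1 \<le> F" using N_Suc_le[of 0] norm_f_le[of 0] T X1 by simp
    then show ?case using run X1 by (simp add: hist_def)
  next
    case (step t)
    then obtain c where c: "?run t = Some (hist t, c)" "invariant t c" by auto
    have t: "1 \<le> t" "t < T" using step by auto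
    then obtain s where s: "t = Suc s" by (cases t) auto
    have "l2_norm_list (misspec \<Delta> (hist t)) \<le> h * l2_norm_list (hist t)"
      using w t c(1) by blast
    moreover have "misspec \<Delta> (hist t) = map W [1..<Suc t]"
      unfolding hist_def misspec_map W_def ..
    ultimately have "sqrt (energy W t) \<le> h * N t" by (simp only: l2_norm_list_energy l2_norm_list_hist)
    then have "(sqrt (energy W t))\<^sup>2 \<le> (h * N t)\<^sup>2" by (rule power_mono) simp
    then have "bounded_misspec t" using t by (simp add: bounded_misspec_def power_mult_distrib N_sq)
    from invariant_good_play[OF this c(2)] obtain u c' where
      u: "play d M L (1 / Z) \<alpha> (hist t) c = Some (u, c')" "driven t u \<longrightarrow> invariant (Suc t) c'"
      by (auto simp: good_play_def)
    have run: "?run (Suc t) = Some (hist t @ [A *\<^sub>v X t + B *\<^sub>v u + W t + f t], c')"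
    proof -
      have "W t = \<Delta> t (hist t)" unfolding W_def hist_def ..
      then show ?thesis using c(1) u(1) obs_hist[OF t(1) order_refl] by (simp add: s Z_def \<alpha>_def)
    qed
    then have XS: "X (Suc t) = A *\<^sub>v X t + B *\<^sub>v u + W t + f t" by (simp add: X_def)
    have "hist (Suc t) = hist t @ [X (Suc t)]" by (simp add: hist_def)
    then show ?case using run u(2) XS by (simp add: driven_def)
  qed
  then obtain c where c: "?run T = Some (hist T, c)" "invariant T c" using T by blast
  have "N T \<le> \<Gamma>\<^sup>2 * F" by (rule invariant_N_le[OF c(2)])
  also have "\<dots> \<le> Z powr (1024 * real d) * F" by (intro mult_right_mono Gamma_sq_le F_nonneg)
  finally show "\<exists>xs c. ?run T = Some (xs, c) \<and>
      l2_norm_list xs \<le> probe_ratio d M L powr (1024 * real d) * l2_norm_list (map f [0..<T])"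
    using c(1) by (auto simp: l2_norm_list_upt_0 F_def Z_def)
qed

lemma parameters_pos:
  assumes "1 \<le> d" "1 \<le> M" "0 < L"
  shows "0 < 1 / probe_ratio d M L" "0 < alarm_factor d M L"
proof -
  have "0 < probe_ratio d M L" using assms by (simp add: probe_ratio_def)
  then show "0 < 1 / probe_ratio d M L" "0 < alarm_factor d M L"
    using assms by (simp_all add: alarm_factor_def)
qed

theorem theorem1:
  shows "\<exists>C::real. C \<ge> 1 \<and>
    (\<forall>(d::nat) (M::real) (L::real). d \<ge> 1 \<longrightarrow> M \<ge> 1 \<longrightarrow> 0 < L \<longrightarrow> L \<le> 1 \<longrightarrow>
      (\<exists>(\<epsilon>::real) (\<alpha>::real). \<epsilon> > 0 \<and> \<alpha> > 0 \<and>
        (\<forall>h::real. 0 \<le> h \<longrightarrow> h \<le> 1 / (12 * sqrt (real d)) \<longrightarrow>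
          l2_gain_le d M L h \<epsilon> \<alpha> ((C * M * real d / L) powr (C * real d)))))"
proof (rule exI[of _ "1024 :: real"], intro conjI allI impI)
  fix d :: nat and M L :: real
  assume *: "d \<ge> 1" "M \<ge> 1" "0 < L" "L \<le> 1"
  show "\<exists>(\<epsilon>::real) (\<alpha>::real). \<epsilon> > 0 \<and> \<alpha> > 0 \<and>
        (\<forall>h::real. 0 \<le> h \<longrightarrow> h \<le> 1 / (12 * sqrt (real d)) \<longrightarrow>
          l2_gain_le d M L h \<epsilon> \<alpha> ((1024 * M * real d / L) powr (1024 * real d)))"
  proof (intro exI conjI allI impI)
    show "0 < 1 / probe_ratio d M L" "0 < alarm_factor d M L"
      using parameters_pos[OF *(1-3)] by blast+
    show "l2_gain_le d M L h (1 / probe_ratio d M L) (alarm_factor d M L)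
        ((1024 * M * real d / L) powr (1024 * real d))"
      if "0 \<le> h" "h \<le> 1 / (12 * sqrt (real d))" for h
      using gain_bound[OF * that] by (simp add: probe_ratio_def)
  qed
qed simp

end
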